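(* Let $\Omega\subset\mathbb R^n$ be an open bounded domain of class $C^1$, let $a,b>0$ be constants, and let $\varphi\in C^1([0,\infty)\times\Omega\times\mathbb R\times\mathbb R,\mathbb R)$ (not necessarily of constant sign) satisfy $$\varphi(t,x,u,0)=\varphi(t,x,0,v)=0\quad\text{for all } u\ge 0,\ v\ge 0,\ t>0,\ x\in\Omega,$$ and, for some $r\ge 1$ and positive constants $C_1,C_2$, $$|\varphi(t,x,s_1,s_2)|\le C_1+C_2(s_1+s_2)^r\quad\text{for all } s_1,s_2\ge 0 \text{ and all } t>0,\ x\in\Omega .$$ Let $(u,v)$ be a positive (i.e. componentwise nonnegative) solution, on its maximal interval of existence $(0,T_{\max})$, of $$\begin{cases}\partial_t u-a\Delta u=f(t,x,u,v):=-\varphi(t,x,u,v) & \text{in } (0,T_{\max})\times\Omega,\\ \partial_t v-b\Delta v=g(t,x,u,v):=\varphi(t,x,u,v) & \text{in } (0,T_{\max})\times\Omega,\\ \frac{\partial u}{\partial\eta}=\frac{\partial v}{\partial\eta}=0 & \text{on } (0,T_{\max})\times\partial\Omega,\\ u(0,x)=u_0(x),\quad v(0,x)=v_0(x) & \text{in }\Omega,\end{cases}$$ with $u_0,v_0$ bounded and nonnegative on $\Omega$. Let $p\ge 1$ be a fixed integer and let $$L(t)=\int_\Omega \sum_{i=0}^p \binom{p}{i}\,\theta_i\, u(t,x)^i\, v(t,x)^{p-i}\,dx ,$$ where the finite sequence of positive numbers $(\theta_i)$ is the one defined in the context (it depends on $a$, $b$, $p$ and on which of the sign situations (A), (B) described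 there holds). Then $L$ is uniformly bounded on $(0,T_{\max})$: there is a constant $M>0$, independent of $t$, such that $L(t)\le M$ for all $t\in(0,T_{\max})$.
   Context: $\frac{\partial}{\partial\eta}$ is the outward normal derivative on $\partial\Omega$. Solutions are classical; $T_{\max}\in(0,\infty]$ is the maximal existence time, and if $T_{\max}<\infty$ then $\lim_{t\nearrow T_{\max}}\left(\|u(t,\cdot)\|_{\infty}+\|v(t,\cdot)\|_{\infty}\right)=\infty$. Sign situations. Write $T=T_{\max}$. Let $\overline t$ denote the greatest time in $(0,T)$ such that $\varphi(\overline t,\overline x,\overline u,\overline v)=0$ for some $(\overline x,\overline u,\overline v)\in\Omega\times(0,\infty)\times(0,\infty)$. The two situations considered are: (A) $f(t,x,u,v)<0$ for all $t\in(\overline t,T)$, $x\in\Omega$, $(u,v)\in(0,\infty)\times(0,\infty)$; (B) $f(t,x,u,v)>0$ for all $t\in(\overline t,T)$, $x\in\Omega$, $(u,v)\in(0,\infty)\times(0,\infty)$. Definition of $\theta_i$. Let $K>0$ be any constant with $K^2>\frac{(a+b)^2}{4ab}$ and let $c,C>0$ be constants with $cK^{2p+1}<1<CK$. Then $\theta_i=c^{\,i+1}K^{i^2}$, $i=0,1,2,\dots$, when the nonlinearity satisfies (A), and $\theta_i=C^{\,i+1}K^{i^2}$, $i=0,1,2,\dots$, when the nonlinearity satisfies (B). *)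

theory Defs
  imports "HOL-Analysis.Analysis"
begin

definition C1_on :: "'a::real_normed_vector set \<Rightarrow> ('a \<Rightarrow> 'b::real_normed_vector) \<Rightarrow> bool" where
  "C1_on S f \<longleftrightarrow>
     (\<exists>f'. continuous_on S f' \<and>
           (\<forall>x\<in>S. (f has_derivative blinfun_apply (f' x)) (at x within S)))"

(* rho is a C^1 defining function for Omega on the neighbourhood U of x, with gradient G.
   As G does not vanish, frontier Omega and {rho = 0} coincide inside U, and Omega lies on
   one side of its boundary. *)
definition local_defining_function ::
  "'a::euclidean_space set \<Rightarrow> 'a \<Rightarrow> 'a set \<Rightarrow> ('a \<Rightarrow> real) \<Rightarrow> ('a \<Rightarrow> 'a) \<Rightarrow> bool" where
  "local_defining_function \<Omega> x U \<rho> G \<longleftrightarrow>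
     open U \<and> x \<in> U \<and> continuous_on U G \<and>
     (\<forall>y\<in>U. (\<rho> has_derivative (\<lambda>h. G y \<bullet> h)) (at y) \<and> G y \<noteq> 0) \<and>
     \<Omega> \<inter> U = {y \<in> U. \<rho> y < 0}"

definition bounded_C1_domain :: "'a::euclidean_space set \<Rightarrow> bool" where
  "bounded_C1_domain \<Omega> \<longleftrightarrow>
     open \<Omega> \<and> connected \<Omega> \<and> \<Omega> \<noteq> {} \<and> bounded \<Omega> \<and>
     (\<forall>x\<in>frontier \<Omega>. \<exists>U \<rho> G. local_defining_function \<Omega> x U \<rho> G)"

definition outward_unit_normal :: "'a::euclidean_space set \<Rightarrow> 'a \<Rightarrow> 'a \<Rightarrow> bool" where
  "outward_unit_normal \<Omega> x \<eta> \<longleftrightarrow>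
     x \<in> frontier \<Omega> \<and> (\<exists>U \<rho> G. local_defining_function \<Omega> x U \<rho> G \<and> \<eta> = sgn (G x))"

(* One-sided derivative, along the outward normal, of a function on the closure of Omega. *)
definition has_normal_derivative ::
  "'a::euclidean_space set \<Rightarrow> ('a \<Rightarrow> real) \<Rightarrow> real \<Rightarrow> 'a \<Rightarrow> bool" where
  "has_normal_derivative \<Omega> w d x \<longleftrightarrow>
     (\<forall>\<eta>. outward_unit_normal \<Omega> x \<eta> \<longrightarrow>
        (\<exists>D. (w has_derivative D) (at x within closure \<Omega>) \<and> D \<eta> = d))"

definition partial_deriv :: "'a::euclidean_space \<Rightarrow> ('a \<Rightarrow> real) \<Rightarrow> 'a \<Rightarrow> real" where
  "partial_deriv b w x = deriv (\<lambda>h. w (x + h *\<^sub>R b)) 0"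

definition laplacian :: "('a::euclidean_space \<Rightarrow> real) \<Rightarrow> 'a \<Rightarrow> real" where
  "laplacian w x = (\<Sum>b\<in>Basis. partial_deriv b (partial_deriv b w) x)"

definition time_interval :: "ereal \<Rightarrow> real set" where
  "time_interval T = {t. 0 < t \<and> ereal t < T}"

(* Regularity of a classical solution: C^1 in t and C^2 in x on (0,T) x Omega, and C^1 in x up to
   the boundary, so that the Neumann condition makes sense. *)
definition classical_regularity ::
  "'a::euclidean_space set \<Rightarrow> ereal \<Rightarrow> (real \<Rightarrow> 'a \<Rightarrow> real) \<Rightarrow> bool" where
  "classical_regularity \<Omega> T w \<longleftrightarrow>
     (\<forall>t\<in>time_interval T. \<forall>x\<in>\<Omega>. (\<lambda>s. w s x) differentiable (at t)) \<and>
     continuous_on (time_interval T \<times> \<Omega>) (\<lambda>(t, x). deriv (\<lambda>s. w s x) t) \<and>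
     continuous_on (time_interval T \<times> closure \<Omega>) (\<lambda>(t, x). w t x) \<and>
     (\<exists>G. continuous_on (time_interval T \<times> closure \<Omega>) (\<lambda>(t, x). G t x) \<and>
          (\<forall>t\<in>time_interval T. \<forall>x\<in>closure \<Omega>.
             (w t has_derivative (\<lambda>h. G t x \<bullet> h)) (at x within closure \<Omega>))) \<and>
     (\<forall>b\<in>Basis. \<forall>c\<in>Basis.
        (\<forall>t\<in>time_interval T. \<forall>x\<in>\<Omega>.
           (\<lambda>h. partial_deriv b (w t) (x + h *\<^sub>R c)) differentiable (at 0)) \<and>
        continuous_on (time_interval T \<times> \<Omega>)
          (\<lambda>(t, x). partial_deriv c (partial_deriv b (w t)) x))"

(* The initial datum is only assumed bounded, so w(t,.) need not converge to it uniformly or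
   even pointwise as t -> 0+: w stays bounded near t = 0 and converges in L^1(Omega), hence in
   every L^q(Omega) with q finite.  Boundedness is part of the notion: without it the Neumann
   heat kernel with pole on the boundary would be a solution with zero initial datum in the
   pointwise sense. *)
definition attains_initial_datum ::
  "'a::euclidean_space set \<Rightarrow> ereal \<Rightarrow> (real \<Rightarrow> 'a \<Rightarrow> real) \<Rightarrow> ('a \<Rightarrow> real) \<Rightarrow> bool" where
  "attains_initial_datum \<Omega> T w w0 \<longleftrightarrow>
     (\<forall>x\<in>\<Omega>. w 0 x = w0 x) \<and>
     (\<exists>\<delta>>0. \<exists>B. \<forall>t\<in>time_interval T. t \<le> \<delta> \<longrightarrow> (\<forall>x\<in>\<Omega>. \<bar>w t x\<bar> \<le> B)) \<and>
     ((\<lambda>t. LINT x:\<Omega>|lebesgue. \<bar>w t x - w0 x\<bar>) \<longlongrightarrow> 0) (at_right 0)"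

type_synonym 'a reaction = "real \<Rightarrow> 'a \<Rightarrow> real \<Rightarrow> real \<Rightarrow> real"

definition classical_solution ::
  "'a::euclidean_space set \<Rightarrow> real \<Rightarrow> real \<Rightarrow> 'a reaction \<Rightarrow> 'a reaction \<Rightarrow>
   ('a \<Rightarrow> real) \<Rightarrow> ('a \<Rightarrow> real) \<Rightarrow> ereal \<Rightarrow>
   (real \<Rightarrow> 'a \<Rightarrow> real) \<Rightarrow> (real \<Rightarrow> 'a \<Rightarrow> real) \<Rightarrow> bool" where
  "classical_solution \<Omega> a b f g u0 v0 T u v \<longleftrightarrow>
     classical_regularity \<Omega> T u \<and> classical_regularity \<Omega> T v \<and>
     (\<forall>t\<in>time_interval T. \<forall>x\<in>\<Omega>.
        deriv (\<lambda>s. u s x) t - a * laplacian (u t) x = f t x (u t x) (v t x) \<and>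
        deriv (\<lambda>s. v s x) t - b * laplacian (v t) x = g t x (u t x) (v t x)) \<and>
     (\<forall>t\<in>time_interval T. \<forall>x\<in>frontier \<Omega>.
        has_normal_derivative \<Omega> (u t) 0 x \<and> has_normal_derivative \<Omega> (v t) 0 x) \<and>
     attains_initial_datum \<Omega> T u u0 \<and> attains_initial_datum \<Omega> T v v0"

definition maximal_classical_solution ::
  "'a::euclidean_space set \<Rightarrow> real \<Rightarrow> real \<Rightarrow> 'a reaction \<Rightarrow> 'a reaction \<Rightarrow>
   ('a \<Rightarrow> real) \<Rightarrow> ('a \<Rightarrow> real) \<Rightarrow> ereal \<Rightarrow>
   (real \<Rightarrow> 'a \<Rightarrow> real) \<Rightarrow> (real \<Rightarrow> 'a \<Rightarrow> real) \<Rightarrow> bool" where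
  "maximal_classical_solution \<Omega> a b f g u0 v0 T u v \<longleftrightarrow>
     0 < T \<and> classical_solution \<Omega> a b f g u0 v0 T u v \<and>
     \<not> (\<exists>T' u' v'. T < T' \<and> classical_solution \<Omega> a b f g u0 v0 T' u' v' \<and>
          (\<forall>t\<in>time_interval T. \<forall>x\<in>closure \<Omega>. u' t x = u t x \<and> v' t x = v t x))"

definition sup_norm :: "'a set \<Rightarrow> ('a \<Rightarrow> real) \<Rightarrow> real" where
  "sup_norm \<Omega> w = (SUP x\<in>\<Omega>. \<bar>w x\<bar>)"

definition blow_up_alternative ::
  "'a set \<Rightarrow> ereal \<Rightarrow> (real \<Rightarrow> 'a \<Rightarrow> real) \<Rightarrow> (real \<Rightarrow> 'a \<Rightarrow> real) \<Rightarrow> bool" where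
  "blow_up_alternative \<Omega> T u v \<longleftrightarrow>
     (\<forall>T1. T = ereal T1 \<longrightarrow>
        filterlim (\<lambda>t. sup_norm \<Omega> (u t) + sup_norm \<Omega> (v t)) at_top (at_left T1))"

definition zero_times :: "'a set \<Rightarrow> ereal \<Rightarrow> 'a reaction \<Rightarrow> real set" where
  "zero_times \<Omega> T \<phi> =
     {t \<in> time_interval T. \<exists>x\<in>\<Omega>. \<exists>r>0. \<exists>s>0. \<phi> t x r s = 0}"

definition greatest_zero_time :: "'a set \<Rightarrow> ereal \<Rightarrow> 'a reaction \<Rightarrow> real \<Rightarrow> bool" where
  "greatest_zero_time \<Omega> T \<phi> tbar \<longleftrightarrow>
     tbar \<in> zero_times \<Omega> T \<phi> \<and> (\<forall>t\<in>zero_times \<Omega> T \<phi>. t \<le> tbar)"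

definition situation_A :: "'a set \<Rightarrow> ereal \<Rightarrow> 'a reaction \<Rightarrow> real \<Rightarrow> bool" where
  "situation_A \<Omega> T f tbar \<longleftrightarrow>
     (\<forall>t\<in>time_interval T. tbar < t \<longrightarrow> (\<forall>x\<in>\<Omega>. \<forall>r>0. \<forall>s>0. f t x r s < 0))"

definition situation_B :: "'a set \<Rightarrow> ereal \<Rightarrow> 'a reaction \<Rightarrow> real \<Rightarrow> bool" where
  "situation_B \<Omega> T f tbar \<longleftrightarrow>
     (\<forall>t\<in>time_interval T. tbar < t \<longrightarrow> (\<forall>x\<in>\<Omega>. \<forall>r>0. \<forall>s>0. f t x r s > 0))"

definition theta :: "real \<Rightarrow> real \<Rightarrow> nat \<Rightarrow> real" where
  "theta c K i = c ^ (i + 1) * K ^ (i\<^sup>2)"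

definition lyapunov ::
  "'a::euclidean_space set \<Rightarrow> nat \<Rightarrow> (nat \<Rightarrow> real) \<Rightarrow>
   (real \<Rightarrow> 'a \<Rightarrow> real) \<Rightarrow> (real \<Rightarrow> 'a \<Rightarrow> real) \<Rightarrow> real \<Rightarrow> real" where
  "lyapunov \<Omega> p \<theta> u v t =
     (LINT x:\<Omega>|lebesgue. \<Sum>i\<le>p. real (p choose i) * \<theta> i * u t x ^ i * v t x ^ (p - i))"

end

theory Submission
  imports Defs
begin

text \<open>
The functional built from \<open>\<theta>\<close> is controlled by a second functional of the same shape that decreases in time.
Because \<open>u\<close> and \<open>v\<close> are nonnegative, the functionals belonging to two sequences of positive
coefficients bound each other up to a constant factor. The coefficients can therefore be chosen anew:
\<open>\<tau> i = C ^ (i + 1) * K ^ (i\<^sup>2)\<close>, which increases in \<open>i\<close>, in situation (A), and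
\<open>\<tau> i = c ^ (i + 1) * K ^ (i\<^sup>2)\<close>, which decreases for \<open>i \<le> p\<close>, in situation (B). Write \<open>H u v\<close> for the
resulting form \<open>\<Sum>i\<le>p. (p choose i) * \<tau> i * u ^ i * v ^ (p - i)\<close>, with partial derivatives \<open>H\<^sub>u\<close>, \<open>H\<^sub>v\<close>.

After the last zero time \<open>tbar\<close> the integral of \<open>H u v\<close> is nonincreasing, because two terms have the right sign.
The reaction contributes \<open>(H\<^sub>v - H\<^sub>u) * \<phi>\<close>; the coefficients of \<open>H\<^sub>v - H\<^sub>u\<close> are the differences
\<open>\<tau> i - \<tau> (i + 1)\<close>, whose sign is opposite to that of \<open>\<phi>\<close>. The diffusion contributes the divergence of the
flux \<open>F = a * H\<^sub>u * \<nabla>u + b * H\<^sub>v * \<nabla>v\<close> minus a quadratic form in the gradients, and this form is nonnegative since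
\<open>\<tau> i * \<tau> (i + 2) = K\<^sup>2 * (\<tau> (i + 1))\<^sup>2\<close> makes every discriminant nonpositive
(\<open>theta_discriminant\<close>, \<open>binomial_form_hessian_nonneg\<close>).

The flux has vanishing normal component on the boundary, but its divergence is only known to be continuous inside
\<open>\<Omega>\<close> and may fail to be integrable up to the boundary. The computation is therefore carried out with the integrand
multiplied by a cutoff \<open>\<kappa>\<close> of compact support in \<open>\<Omega>\<close>. The gradient of \<open>\<kappa>\<close> has size \<open>1 / \<epsilon>\<close>, is nearly normal to the
boundary and lives in a strip of measure \<open>O(\<epsilon>)\<close>, on which the normal component of \<open>F\<close> is small; so the error,
the integral of \<open>\<nabla>\<kappa> \<bullet> F\<close>, tends to zero (\<open>global_boundary_cutoff\<close>, \<open>integral_antimono_of_divergence_bound\<close>).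

Fix \<open>t1 > tbar\<close>. On \<open>(0, t1]\<close> the solution is bounded, near \<open>0\<close> by the way in which it attains its initial
datum and on the remaining compact interval by continuity; after \<open>t1\<close> the functional does not exceed its value at \<open>t1\<close>.
\<close>

section \<open>Forms with binomial coefficients\<close>

text \<open>The density of the functional, in the recursive form given by Pascal's rule. The recursion turns the product
rule into a differentiation formula in which a derivative in the first variable shifts the coefficient sequence
by one.\<close>

primrec binomial_form :: "nat \<Rightarrow> (nat \<Rightarrow> real) \<Rightarrow> real \<Rightarrow> real \<Rightarrow> real" where
  "binomial_form 0 \<tau> x y = \<tau> 0"
| "binomial_form (Suc n) \<tau> x y = x * binomial_form n (\<lambda>i. \<tau> (Suc i)) x y + y * binomial_form n \<tau> x y"

lemma binomial_form_eq_sum: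
  "binomial_form n \<tau> x y = (\<Sum>i\<le>n. real (n choose i) * \<tau> i * x ^ i * y ^ (n - i))"
proof (induction n arbitrary: \<tau>)
  case 0
  then show ?case by simp
next
  case (Suc n)
  have "(\<Sum>i\<le>Suc n. real (Suc n choose i) * \<tau> i * x ^ i * y ^ (Suc n - i))
     = \<tau> 0 * y ^ Suc n + (\<Sum>i\<le>n. real (n choose i) * \<tau> (Suc i) * x ^ Suc i * y ^ (n - i))
       + (\<Sum>i\<le>n. real (n choose Suc i) * \<tau> (Suc i) * x ^ Suc i * y ^ (n - i))"
    by (subst sum.atMost_Suc_shift) (simp add: sum.distrib[symmetric] algebra_simps)
  also have "(\<Sum>i\<le>n. real (n choose Suc i) * \<tau> (Suc i) * x ^ Suc i * y ^ (n - i))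
     = (\<Sum>i<n. real (n choose Suc i) * \<tau> (Suc i) * x ^ Suc i * y ^ (n - i))"
    by (intro sum.mono_neutral_right) (auto simp: not_less)
  also have "\<tau> 0 * y ^ Suc n + (\<Sum>i\<le>n. real (n choose i) * \<tau> (Suc i) * x ^ Suc i * y ^ (n - i))
       + (\<Sum>i<n. real (n choose Suc i) * \<tau> (Suc i) * x ^ Suc i * y ^ (n - i))
     = x * binomial_form n (\<lambda>i. \<tau> (Suc i)) x y
       + (\<Sum>i\<le>n. real (n choose i) * \<tau> i * x ^ i * y ^ (Suc n - i))"
    by (subst (2) sum.atMost_shift) (simp add: Suc.IH sum_distrib_left algebra_simps)
  also have "(\<Sum>i\<le>n. real (n choose i) * \<tau> i * x ^ i * y ^ (Suc n - i)) = y * binomial_form n \<tau> x y"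
    by (simp add: Suc.IH sum_distrib_left Suc_diff_le algebra_simps)
  finally show ?case by simp
qed

lemma binomial_form_has_real_derivative:
  assumes "(f has_real_derivative f') (at t within S)" "(g has_real_derivative g') (at t within S)"
  shows "((\<lambda>s. binomial_form n \<tau> (f s) (g s)) has_real_derivative
      real n * (binomial_form (n - 1) (\<lambda>i. \<tau> (Suc i)) (f t) (g t) * f' + binomial_form (n - 1) \<tau> (f t) (g t) * g'))
      (at t within S)"
proof (induction n arbitrary: \<tau>)
  case 0
  then show ?case by simp
next
  case (Suc n)
  have "real n * binomial_form n \<sigma> x y
      = real n * (x * binomial_form (n - 1) (\<lambda>i. \<sigma> (Suc i)) x y + y * binomial_form (n - 1) \<sigma> x y)" for \<sigma> x y
    by (cases n) auto
  then have n: "real n * binomial_form n \<sigma> x y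
      = real n * (x * binomial_form (n - 1) (\<lambda>i. \<sigma> (Suc i)) x y) + real n * (y * binomial_form (n - 1) \<sigma> x y)" for \<sigma> x y
    by (simp add: distrib_left)
  show ?case
    unfolding binomial_form.simps
    by (rule DERIV_cong[OF DERIV_add[OF DERIV_mult[OF assms(1) Suc.IH] DERIV_mult[OF assms(2) Suc.IH]]])
      (simp add: n algebra_simps)
qed

lemma continuous_on_binomial_form [continuous_intros]:
  assumes "continuous_on S f" "continuous_on S g"
  shows "continuous_on S (\<lambda>s. binomial_form n \<tau> (f s) (g s))"
  using assms by (induction n arbitrary: \<tau>) (auto intro!: continuous_intros)

lemma binomial_form_mono:
  assumes "\<And>i. i \<le> n \<Longrightarrow> \<sigma> i \<le> \<tau> i" "0 \<le> x" "0 \<le> y"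
  shows "binomial_form n \<sigma> x y \<le> binomial_form n \<tau> x y"
  unfolding binomial_form_eq_sum using assms by (auto intro!: sum_mono mult_right_mono mult_left_mono)

lemma binomial_form_add: "binomial_form n (\<lambda>i. \<sigma> i + \<tau> i) x y = binomial_form n \<sigma> x y + binomial_form n \<tau> x y"
  by (simp add: binomial_form_eq_sum sum.distrib algebra_simps)

lemma binomial_form_scale: "binomial_form n (\<lambda>i. k * \<tau> i) x y = k * binomial_form n \<tau> x y"
  by (simp add: binomial_form_eq_sum sum_distrib_left algebra_simps)

lemma binomial_form_nonneg:
  assumes "\<And>i. i \<le> n \<Longrightarrow> 0 \<le> \<tau> i" "0 \<le> x" "0 \<le> y"
  shows "0 \<le> binomial_form n \<tau> x y"
  unfolding binomial_form_eq_sum using assms by (auto intro!: sum_nonneg mult_nonneg_nonneg)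

lemma quadratic_form_nonneg:
  fixes A B C X Y :: real
  assumes "0 < A" "B\<^sup>2 \<le> 4 * A * C"
  shows "0 \<le> A * X\<^sup>2 + B * X * Y + C * Y\<^sup>2"
proof -
  have "4 * A * (A * X\<^sup>2 + B * X * Y + C * Y\<^sup>2) = (2 * A * X + B * Y)\<^sup>2 + (4 * A * C - B\<^sup>2) * Y\<^sup>2"
    by (simp add: power2_eq_square algebra_simps)
  also have "\<dots> \<ge> 0" using assms by (intro add_nonneg_nonneg mult_nonneg_nonneg) auto
  finally show ?thesis using assms(1) by (simp add: zero_le_mult_iff)
qed

text \<open>The integrand of the diffusion term is again a binomial form: its \<open>i\<close>-th coefficient is the quadratic form in
\<open>X\<close> and \<open>Y\<close> with coefficients \<open>a * \<tau> (i + 2)\<close>, \<open>(a + b) * \<tau> (i + 1)\<close>, \<open>b * \<tau> i\<close>, and the discriminant condition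
makes each of these nonnegative.\<close>

lemma binomial_form_hessian_nonneg:
  assumes "\<And>i. 0 < \<tau> i" "0 < a" "\<And>i. ((a + b) * \<tau> (Suc i))\<^sup>2 \<le> 4 * a * b * \<tau> i * \<tau> (Suc (Suc i))"
    and "0 \<le> x" "0 \<le> y"
  shows "0 \<le> a * binomial_form n (\<lambda>i. \<tau> (Suc (Suc i))) x y * X\<^sup>2
              + (a + b) * binomial_form n (\<lambda>i. \<tau> (Suc i)) x y * X * Y + b * binomial_form n \<tau> x y * Y\<^sup>2"
proof -
  have "0 \<le> binomial_form n (\<lambda>i. (a * X\<^sup>2) * \<tau> (Suc (Suc i)) + (((a + b) * X * Y) * \<tau> (Suc i) + (b * Y\<^sup>2) * \<tau> i)) x y"
  proof (intro binomial_form_nonneg assms)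
    fix i
    have "0 \<le> (a * \<tau> (Suc (Suc i))) * X\<^sup>2 + ((a + b) * \<tau> (Suc i)) * X * Y + (b * \<tau> i) * Y\<^sup>2"
      using assms(1,2) assms(3)[of i] by (intro quadratic_form_nonneg) (auto simp: algebra_simps)
    then show "0 \<le> (a * X\<^sup>2) * \<tau> (Suc (Suc i)) + (((a + b) * X * Y) * \<tau> (Suc i) + (b * Y\<^sup>2) * \<tau> i)"
      by (simp add: algebra_simps)
  qed
  then show ?thesis unfolding binomial_form_add binomial_form_scale by (simp add: algebra_simps)
qed

text \<open>The exponents \<open>i\<^sup>2\<close> have second difference 2, so \<open>\<theta> i * \<theta> (i + 2) / (\<theta> (i + 1))\<^sup>2 = K\<^sup>2\<close> whatever the
base \<open>d\<close>; this is where the lower bound on \<open>K\<close> enters.\<close>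

lemma theta_discriminant:
  assumes "0 < a" "0 < b" "(a + b)\<^sup>2 / (4 * a * b) \<le> K\<^sup>2" "0 < K" "0 < d"
  shows "((a + b) * theta d K (Suc i))\<^sup>2 \<le> 4 * a * b * theta d K i * theta d K (Suc (Suc i))"
proof -
  have "theta d K i * theta d K (Suc (Suc i)) = K\<^sup>2 * (theta d K (Suc i))\<^sup>2"
  proof -
    have "i\<^sup>2 + (Suc (Suc i))\<^sup>2 = 2 + (Suc i)\<^sup>2 * 2" "(i + 1) + (Suc (Suc i) + 1) = (Suc i + 1) * 2"
      by (auto simp: power2_eq_square)
    then have "d ^ (i + 1) * d ^ (Suc (Suc i) + 1) = (d ^ (Suc i + 1))\<^sup>2"
      "K ^ (i\<^sup>2) * K ^ ((Suc (Suc i))\<^sup>2) = K\<^sup>2 * (K ^ ((Suc i)\<^sup>2))\<^sup>2"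
      unfolding power_mult[symmetric] power_add[symmetric] by (simp_all only:)
    then show ?thesis
      unfolding theta_def power_mult_distrib by (metis mult.assoc mult.left_commute)
  qed
  moreover have "(a + b)\<^sup>2 \<le> 4 * a * b * K\<^sup>2"
    using assms by (simp add: divide_simps algebra_simps)
  then have "(a + b)\<^sup>2 * (theta d K (Suc i))\<^sup>2 \<le> (4 * a * b * K\<^sup>2) * (theta d K (Suc i))\<^sup>2"
    by (rule mult_right_mono) simp
  ultimately show ?thesis by (simp add: power_mult_distrib mult.assoc mult.left_commute)
qed

section \<open>Differentiation under the integral sign\<close>

text \<open>By dominated convergence of the difference quotients, which the mean value theorem bounds by \<open>B\<close>.\<close>

lemma has_real_derivative_integral:
  fixes q q' :: "real \<Rightarrow> 'b \<Rightarrow> real"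
  assumes S: "convex S" "t \<in> S"
    and int: "\<And>s. s \<in> S \<Longrightarrow> integrable M (q s)"
    and deriv: "\<And>s x. s \<in> S \<Longrightarrow> ((\<lambda>s. q s x) has_real_derivative q' s x) (at s within S)"
    and bound: "\<And>s x. s \<in> S \<Longrightarrow> \<bar>q' s x\<bar> \<le> B x"
    and B: "integrable M B"
    and meas: "q' t \<in> borel_measurable M"
  shows "((\<lambda>s. \<integral>x. q s x \<partial>M) has_real_derivative (\<integral>x. q' t x \<partial>M)) (at t within S)"
  unfolding has_field_derivative_iff tendsto_at_iff_sequentially
proof (intro allI impI)
  fix X :: "nat \<Rightarrow> real" assume X: "\<forall>i. X i \<in> S - {t}" "X \<longlonglongrightarrow> t"
  let ?d = "\<lambda>i x. (q (X i) x - q t x) / (X i - t)"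
  have "(\<lambda>i. \<integral>x. ?d i x \<partial>M) \<longlonglongrightarrow> (\<integral>x. q' t x \<partial>M)"
  proof (rule integral_dominated_convergence[where w = B])
    show "?d i \<in> borel_measurable M" for i
      using int S X by (auto intro!: borel_measurable_divide borel_measurable_diff borel_measurable_integrable)
    show "AE x in M. (\<lambda>i. ?d i x) \<longlonglongrightarrow> q' t x"
      using deriv[OF S(2)] X unfolding has_field_derivative_iff tendsto_at_iff_sequentially
      by (auto simp: o_def)
    show "AE x in M. norm (?d i x) \<le> B x" for i
    proof (rule AE_I2)
      fix x
      have "norm (q (X i) x - q t x) \<le> B x * norm (X i - t)"
        using X S by (intro field_differentiable_bound[where f' = "\<lambda>s. q' s x" and S = S] deriv)
          (auto intro: bound)
      then show "norm (?d i x) \<le> B x"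
        using X by (auto simp: divide_simps)
    qed
  qed (use B meas in auto)
  moreover have "(\<integral>x. ?d i x \<partial>M) = ((\<integral>x. q (X i) x \<partial>M) - (\<integral>x. q t x \<partial>M)) / (X i - t)" for i
    using int X S by (simp add: Bochner_Integration.integral_diff)
  ultimately show "((\<lambda>y. ((\<integral>x. q y x \<partial>M) - (\<integral>x. q t x \<partial>M)) / (y - t)) \<circ> X) \<longlonglongrightarrow> (\<integral>x. q' t x \<partial>M)"
    by (simp only: o_def)
qed

text \<open>The divergence theorem for compactly supported fields, one coordinate at a time: the integral of a translate
\<open>w (x + s *\<^sub>R e)\<close> does not depend on \<open>s\<close>, so its derivative in \<open>s\<close>, the integral of the directional derivative,
is zero.\<close>

lemma integral_directional_derivative_eq_0:
  fixes w w' :: "'a::euclidean_space \<Rightarrow> real"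
  assumes deriv: "\<And>x. ((\<lambda>h. w (x + h *\<^sub>R e)) has_real_derivative w' x) (at 0)"
    and bound: "\<And>x. \<bar>w' x\<bar> \<le> M"
    and supp: "bounded V" "\<And>x. x \<notin> V \<Longrightarrow> w x = 0" "\<And>x. x \<notin> V \<Longrightarrow> w' x = 0"
    and int: "integrable lborel w"
    and meas: "w' \<in> borel_measurable lborel"
  shows "(\<integral>x. w' x \<partial>lborel) = 0"
proof -
  obtain R where R: "\<And>x. x \<in> V \<Longrightarrow> norm x \<le> R" using supp(1) unfolding bounded_iff by blast
  define S where "S = {-1..1::real}"
  let ?C = "cball (0::'a) (R + norm e)"
  have shift: "integrable lborel (\<lambda>x. w (x + s *\<^sub>R e)) \<and>
       (\<integral>x. w (x + s *\<^sub>R e) \<partial>lborel) = (\<integral>x. w x \<partial>lborel)" for s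
  proof -
    have eq: "lborel = distr lborel borel (\<lambda>x::'a. s *\<^sub>R e + x)" by (simp add: lborel_distr_plus)
    have "integrable (distr lborel borel (\<lambda>x::'a. s *\<^sub>R e + x)) w" using int eq by metis
    then have "integrable lborel (\<lambda>x. w (s *\<^sub>R e + x))" 
      by (rule integrable_distr[rotated]) simp
    moreover have "(\<integral>x. w x \<partial>lborel) = (\<integral>x. w (s *\<^sub>R e + x) \<partial>lborel)"
      by (subst eq, subst integral_distr) (use int in auto)
    ultimately show ?thesis by (simp add: add.commute)
  qed
  have "((\<lambda>s. \<integral>x. w (x + s *\<^sub>R e) \<partial>lborel) has_real_derivative
          (\<integral>x. w' (x + 0 *\<^sub>R e) \<partial>lborel)) (at 0 within S)"
  proof (rule has_real_derivative_integral[where B = "\<lambda>x. M * indicator ?C x"])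
    fix s x assume s: "s \<in> S"
    have "((\<lambda>h. w (x + s *\<^sub>R e + (h - s) *\<^sub>R e)) has_real_derivative w' (x + s *\<^sub>R e) * 1) (at s)"
      by (rule DERIV_chain'[where g = "\<lambda>h. w (x + s *\<^sub>R e + h *\<^sub>R e)" and f = "\<lambda>h. h - s"])
        (use deriv[of "x + s *\<^sub>R e"] in \<open>auto intro!: derivative_eq_intros\<close>)
    then show "((\<lambda>s. w (x + s *\<^sub>R e)) has_real_derivative w' (x + s *\<^sub>R e)) (at s within S)"
      by (simp add: algebra_simps has_field_derivative_at_within)
    show "\<bar>w' (x + s *\<^sub>R e)\<bar> \<le> M * indicator ?C x"
    proof (cases "x + s *\<^sub>R e \<in> V")
      case True
      have "norm x \<le> norm (x + s *\<^sub>R e) + norm (s *\<^sub>R e)" by (metis add_diff_cancel_right' norm_triangle_ineq4)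
      moreover have "norm (s *\<^sub>R e) \<le> norm e" using s by (auto simp: S_def intro!: mult_left_le_one_le)
      ultimately have "x \<in> ?C" using R[OF True] by auto
      then show ?thesis using bound by simp
    next
      case False
      have "0 \<le> M" using bound[of x] by linarith
      then show ?thesis using supp(3)[OF False] by simp
    qed
  next
    show "integrable lborel (\<lambda>x. M * indicator ?C x)"
      by (intro integrable_mult_right integrable_real_indicator)
         (use emeasure_bounded_finite[OF bounded_cball, of "0::'a" "R + norm e"] in auto)
  qed (use shift meas in \<open>auto simp: S_def\<close>)
  then have "((\<lambda>s. \<integral>x. w x \<partial>lborel) has_real_derivative (\<integral>x. w' x \<partial>lborel)) (at 0 within S)"
    using shift by simp
  moreover have "((\<lambda>s. \<integral>x. w x \<partial>lborel) has_real_derivative 0) (at 0 within S)" by simp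
  moreover have "(0::real) islimpt S" unfolding S_def by (simp add: islimpt_Icc)
  ultimately show ?thesis
    using has_field_derivative_unique trivial_limit_within by metis
qed


section \<open>A step function with a continuous derivative\<close>

definition step_down :: "real \<Rightarrow> real" where
  "step_down s = (max 0 (1 - (max 0 s)\<^sup>2))\<^sup>2"

definition step_down' :: "real \<Rightarrow> real" where
  "step_down' s = - 4 * max 0 (1 - (max 0 s)\<^sup>2) * max 0 s"

lemma max_0_square_has_real_derivative:
  "((\<lambda>s. (max 0 s)\<^sup>2) has_real_derivative 2 * max 0 s) (at (s::real))"
proof (cases "s = 0")
  case True
  show ?thesis
    unfolding CARAT_DERIV True
  proof (intro exI[of _ "\<lambda>z. max 0 z"] conjI allI)
    show "isCont (max 0) (0::real)" by (intro continuous_intros)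
  qed (auto simp: power2_eq_square max_def)
next
  case False
  then consider "s > 0" | "s < 0" by linarith
  then show ?thesis
  proof cases
    case 1
    have "((\<lambda>s. s\<^sup>2) has_real_derivative 2 * max 0 s) (at s)"
      using 1 by (auto intro!: derivative_eq_intros)
    then show ?thesis
      by (rule has_field_derivative_transform_within_open[where S = "{0<..}"]) (use 1 in auto)
  next
    case 2
    have "((\<lambda>s. 0) has_real_derivative 2 * max 0 s) (at s)"
      using 2 by (auto intro!: derivative_eq_intros)
    then show ?thesis
      by (rule has_field_derivative_transform_within_open[where S = "{..<0}"]) (use 2 in auto)
  qed
qed

lemma step_down_has_real_derivative:
  "(step_down has_real_derivative step_down' s) (at s)"
proof -
  have "((\<lambda>s. 1 - (max 0 s)\<^sup>2) has_real_derivative - (2 * max 0 s)) (at s)"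
    using DERIV_diff[OF DERIV_const[of 1] max_0_square_has_real_derivative[of s]] by simp
  from DERIV_chain2[OF max_0_square_has_real_derivative this] show ?thesis
    unfolding step_down_def[abs_def] step_down'_def by (simp add: algebra_simps)
qed

lemma step_down_bounds: "0 \<le> step_down s" "step_down s \<le> 1" "\<bar>step_down' s\<bar> \<le> 4"
proof -
  let ?k = "max 0 (1 - (max 0 s)\<^sup>2)"
  have k: "0 \<le> ?k" "?k \<le> 1" by auto
  show "0 \<le> step_down s" by (simp add: step_down_def)
  show "step_down s \<le> 1" unfolding step_down_def using k by (intro power_le_one)
  show "\<bar>step_down' s\<bar> \<le> 4"
  proof (cases "s \<le> 1")
    case True
    have "?k * max 0 s \<le> 1 * 1" using True k by (intro mult_mono) auto
    then show ?thesis using k by (simp add: step_down'_def abs_mult)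
  next
    case False
    then have "1 \<le> s\<^sup>2" by simp
    then show ?thesis using False by (simp add: step_down'_def)
  qed
qed

lemma step_down_le_0 [simp]: "s \<le> 0 \<Longrightarrow> step_down s = 1" "s \<le> 0 \<Longrightarrow> step_down' s = 0"
  by (simp_all add: step_down_def step_down'_def)

lemma step_down_ge_1 [simp]: "1 \<le> s \<Longrightarrow> step_down s = 0" "1 \<le> s \<Longrightarrow> step_down' s = 0"
  using one_le_power[of s 2] by (simp_all add: step_down_def step_down'_def)

lemma continuous_on_step_down [continuous_intros]:
  assumes "continuous_on S f"
  shows "continuous_on S (\<lambda>x. step_down (f x))" "continuous_on S (\<lambda>x. step_down' (f x))"
  unfolding step_down_def step_down'_def using assms by (auto intro!: continuous_intros)

section \<open>The boundary strip and the normal derivative\<close>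

text \<open>Along every line in direction \<open>e\<close> the function \<open>\<rho>\<close> grows with slope at least \<open>m\<close>, so two points of the strip
on such a line are less than \<open>\<epsilon> / m\<close> apart. The translates of the strip by multiples of \<open>(\<epsilon> / m) *\<^sub>R e\<close> are
therefore disjoint. About \<open>m / \<epsilon>\<close> of them fit into a fixed larger ball, which bounds the measure of each.\<close>

lemma measure_strip_le:
  fixes \<rho> :: "'a::euclidean_space \<Rightarrow> real"
  assumes \<rho>: "\<And>y. y \<in> ball x0 R \<Longrightarrow> (\<rho> has_derivative (\<lambda>h. G y \<bullet> h)) (at y)"
    and m: "\<And>y. y \<in> ball x0 R \<Longrightarrow> m \<le> G y \<bullet> e" "0 < m"
    and e: "norm e \<le> 1" and \<epsilon>: "0 < \<epsilon>" "\<epsilon> \<le> m"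
  defines "S \<equiv> {y \<in> ball x0 R. - \<epsilon> < \<rho> y \<and> \<rho> y < 0}"
  shows "open S" "measure lebesgue S \<le> 2 * measure lebesgue (ball x0 (R + 1)) / m * \<epsilon>"
proof -
  have "continuous_on (ball x0 R) \<rho>"
    using \<rho> by (meson continuous_at_imp_continuous_on has_derivative_continuous)
  then have "open (ball x0 R \<inter> \<rho> -` {- \<epsilon><..<0})"
    by (intro continuous_open_preimage) auto
  moreover have "S = ball x0 R \<inter> \<rho> -` {- \<epsilon><..<0}" by (auto simp: S_def)
  ultimately show "open S" by simp
  have bS: "bounded S" unfolding S_def by (rule bounded_subset[OF bounded_ball]) auto
  have short: "s < \<epsilon> / m" if s: "0 \<le> s" and y: "y \<in> S" "y + s *\<^sub>R e \<in> S" for s y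
  proof -
    have seg: "y + r *\<^sub>R e \<in> ball x0 R" if "r \<in> {0..s}" for r
    proof (cases "s = 0")
      case True then show ?thesis using y that by (auto simp: S_def)
    next
      case False
      have "(1 - r / s) *\<^sub>R y + (r / s) *\<^sub>R (y + s *\<^sub>R e) \<in> ball x0 R"
        using y that s False by (intro convexD[OF convex_ball]) (auto simp: S_def divide_simps)
      moreover have "(1 - r / s) *\<^sub>R y + (r / s) *\<^sub>R (y + s *\<^sub>R e) = y + r *\<^sub>R e"
        using False by (simp add: algebra_simps)
      ultimately show ?thesis by simp
    qed
    have "((\<lambda>r. \<rho> (y + r *\<^sub>R e)) has_derivative (\<lambda>h. G (y + r *\<^sub>R e) \<bullet> (h *\<^sub>R e))) (at r within {0..s})"
      if "0 \<le> r" "r \<le> s" for r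
    proof (rule has_derivative_compose[where f = "\<lambda>r. y + r *\<^sub>R e"])
      show "((\<lambda>r. y + r *\<^sub>R e) has_derivative (\<lambda>h. h *\<^sub>R e)) (at r within {0..s})"
        by (auto intro!: derivative_eq_intros)
      show "(\<rho> has_derivative (\<bullet>) (G (y + r *\<^sub>R e))) (at (y + r *\<^sub>R e))"
        using that by (intro \<rho> seg) auto
    qed
    from mvt_very_simple[OF s this] obtain r where r: "r \<in> {0..s}"
      "\<rho> (y + s *\<^sub>R e) - \<rho> (y + 0 *\<^sub>R e) = G (y + r *\<^sub>R e) \<bullet> ((s - 0) *\<^sub>R e)" by auto
    have "m * s \<le> (G (y + r *\<^sub>R e) \<bullet> e) * s" using m(1)[OF seg[OF r(1)]] s by (rule mult_right_mono)
    also have "\<dots> < \<epsilon>" using r(2) y by (auto simp: S_def mult.commute)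
    finally show ?thesis using m(2) by (simp add: pos_less_divide_eq mult.commute)
  qed
  define d where "d = \<epsilon> / m"
  have d: "0 < d" "d \<le> 1" using \<epsilon> m(2) by (auto simp: d_def)
  \<comment> \<open>The number of translates is limited by requiring a total displacement \<open>N * d \<le> 1\<close>.\<close>
  define N where "N = nat \<lfloor>1 / d\<rfloor>"
  have N: "real N * d \<le> 1" "1 / (2 * d) \<le> real N"
  proof -
    have "1 \<le> 1 / d" using d by simp
    then have fl: "1 \<le> \<lfloor>1 / d\<rfloor>" by (simp only: one_le_floor)
    then have "int N = \<lfloor>1 / d\<rfloor>" unfolding N_def by (intro nat_0_le) linarith
    then have "real N = of_int \<lfloor>1 / d\<rfloor>" "1 \<le> real N" using fl by linarith+
    moreover from this have "real N \<le> 1 / d" "1 / d < real N + 1" by linarith+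
    ultimately have "real N \<le> 1 / d" "1 / d \<le> 2 * real N" by linarith+
    then show "real N * d \<le> 1" "1 / (2 * d) \<le> real N" using d by (auto simp: field_simps)
  qed
  define W where "W k = (+) ((real k * d) *\<^sub>R e) ` S" for k
  have W: "W k \<in> lmeasurable" for k
    unfolding W_def using bS \<open>open S\<close> by (intro lmeasurable_open bounded_translation open_translation)
  have "disjoint_family_on W {..<N}"
  proof -
    have False if kl: "k < l" and z: "z \<in> W k" "z \<in> W l" for k l z
    proof -
      obtain y y' where y: "y \<in> S" "y' \<in> S" "z = (real k * d) *\<^sub>R e + y'" "z = (real l * d) *\<^sub>R e + y"
        using z by (auto simp: W_def)
      then have "y' = y + ((real l - real k) * d) *\<^sub>R e" by (simp add: algebra_simps)
      then have "(real l - real k) * d < \<epsilon> / m" using y kl d by (intro short[of _ y]) auto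
      moreover have "1 * d \<le> (real l - real k) * d" using kl d by (intro mult_right_mono) auto
      ultimately show False by (simp add: d_def)
    qed
    then show ?thesis unfolding disjoint_family_on_def by (metis disjoint_iff linorder_neqE_nat)
  qed
  then have "measure lebesgue (\<Union>(W ` {..<N})) = (\<Sum>k<N. measure lebesgue (W k))"
    using fmeasurableD[OF W] fmeasurableD2[OF W]
    by (intro measure_finite_Union) (auto simp del: emeasure_completion)
  also have "\<dots> = real N * measure lebesgue S" by (simp add: W_def measure_translation)
  finally have eq: "real N * measure lebesgue S = measure lebesgue (\<Union>(W ` {..<N}))" ..
  have "W k \<subseteq> ball x0 (R + 1)" if "k < N" for k
  proof
    fix z assume "z \<in> W k"
    then obtain y where y: "y \<in> S" "z = (real k * d) *\<^sub>R e + y" by (auto simp: W_def)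
    have "dist x0 z \<le> dist x0 y + norm ((real k * d) *\<^sub>R e)"
      using dist_triangle[of x0 z y] y(2) by (simp add: dist_norm)
    also have "norm ((real k * d) *\<^sub>R e) \<le> (real k * d) * 1" using d e by (simp add: mult_left_le)
    also have "\<dots> \<le> real N * d" using that d by simp
    finally show "z \<in> ball x0 (R + 1)" using N(1) y by (auto simp: S_def)
  qed
  then have "real N * measure lebesgue S \<le> measure lebesgue (ball x0 (R + 1))"
    unfolding eq using fmeasurableD[OF W]
    by (intro measure_mono_fmeasurable lmeasurable_open sets.finite_UN) auto
  moreover have "1 / (2 * d) * measure lebesgue S \<le> real N * measure lebesgue S"
    using N by (intro mult_right_mono) auto
  ultimately have "1 / (2 * d) * measure lebesgue S \<le> measure lebesgue (ball x0 (R + 1))" by linarith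
  then show "measure lebesgue S \<le> 2 * measure lebesgue (ball x0 (R + 1)) / m * \<epsilon>"
    using d m(2) by (simp add: d_def field_simps)
qed

lemma local_defining_function_closure:
  assumes "open \<Omega>" "local_defining_function \<Omega> x U \<rho> G" "y \<in> closure \<Omega>" "y \<in> U"
  shows "\<rho> y \<le> 0" "\<rho> y = 0 \<longleftrightarrow> y \<in> frontier \<Omega>"
proof -
  have U: "open U" "\<Omega> \<inter> U = {y \<in> U. \<rho> y < 0}"
    using assms(2) by (auto simp: local_defining_function_def)
  have "continuous_on U \<rho>"
    using assms(2) unfolding local_defining_function_def
    by (meson continuous_at_imp_continuous_on has_derivative_continuous)
  then have "open (U \<inter> \<rho> -` {0<..})" using U by (intro continuous_open_preimage) auto
  moreover have "(U \<inter> \<rho> -` {0<..}) \<inter> \<Omega> = {}"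
  proof -
    have "\<rho> z < 0" if "z \<in> \<Omega>" "z \<in> U" for z using U(2) that by blast
    then show ?thesis by force
  qed
  ultimately have "(U \<inter> \<rho> -` {0<..}) \<inter> closure \<Omega> = {}" using open_Int_closure_eq_empty by blast
  then show *: "\<rho> y \<le> 0" using assms(3,4) by auto
  have "y \<in> frontier \<Omega> \<longleftrightarrow> y \<notin> \<Omega>" using assms(1,3) by (simp add: frontier_def interior_open)
  also have "\<dots> \<longleftrightarrow> \<not> \<rho> y < 0" using U(2) assms(4) by auto
  finally show "\<rho> y = 0 \<longleftrightarrow> y \<in> frontier \<Omega>" using * by auto
qed

text \<open>The defining condition speaks of some derivative \<open>D\<close> relative to \<open>closure \<Omega>\<close>, which need not be unique
as a linear map for a general set. Its value at \<open>\<eta>\<close> is unique because the ray from \<open>x\<close> in direction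
\<open>- \<eta>\<close> runs inside \<open>\<Omega>\<close> for a short time.\<close>

lemma normal_derivative_eq_inner:
  assumes "open \<Omega>" "has_normal_derivative \<Omega> w d x" "outward_unit_normal \<Omega> x \<eta>"
    and w: "(w has_derivative (\<lambda>h. \<Gamma> \<bullet> h)) (at x within closure \<Omega>)"
  shows "\<Gamma> \<bullet> \<eta> = d"
proof -
  obtain D where D: "(w has_derivative D) (at x within closure \<Omega>)" "D \<eta> = d"
    using assms(2,3) by (auto simp: has_normal_derivative_def)
  obtain U \<rho> G where loc: "local_defining_function \<Omega> x U \<rho> G" and \<eta>: "\<eta> = sgn (G x)"
    and x: "x \<in> frontier \<Omega>" using assms(3) by (auto simp: outward_unit_normal_def)
  have xc: "x \<in> closure \<Omega>" using x by (simp add: frontier_def)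
  have U: "open U" "x \<in> U" "(\<rho> has_derivative (\<lambda>h. G x \<bullet> h)) (at x)" "G x \<noteq> 0"
    "\<Omega> \<inter> U = {y \<in> U. \<rho> y < 0}" using loc by (auto simp: local_defining_function_def)
  have \<rho>x: "\<rho> x = 0" using local_defining_function_closure[OF assms(1) loc xc U(2)] x by simp
  have "((\<lambda>s. \<rho> (x + s *\<^sub>R (- \<eta>))) has_derivative (\<lambda>h. G x \<bullet> (h *\<^sub>R (- \<eta>)))) (at 0)"
  proof (rule has_derivative_compose[where f = "\<lambda>s. x + s *\<^sub>R (- \<eta>)"])
    show "((\<lambda>s. x + s *\<^sub>R (- \<eta>)) has_derivative (\<lambda>h. h *\<^sub>R (- \<eta>))) (at 0)"
      by (auto intro!: derivative_eq_intros)
    show "(\<rho> has_derivative (\<bullet>) (G x)) (at (x + 0 *\<^sub>R (- \<eta>)))" using U(3) by simp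
  qed
  then have "((\<lambda>s. \<rho> (x + s *\<^sub>R (- \<eta>))) has_real_derivative - (G x \<bullet> \<eta>)) (at 0)"
    by (rule has_derivative_imp_has_field_derivative) simp
  moreover have "0 < G x \<bullet> \<eta>" using U(4) by (simp add: \<eta> sgn_div_norm)
  ultimately obtain s1 where s1: "0 < s1" "\<And>s. 0 < s \<Longrightarrow> s < s1 \<Longrightarrow> \<rho> (x + s *\<^sub>R (- \<eta>)) < 0"
    using DERIV_neg_dec_right[of "\<lambda>s. \<rho> (x + s *\<^sub>R (- \<eta>))" "- (G x \<bullet> \<eta>)" 0] \<rho>x by auto
  obtain s2 where s2: "0 < s2" "ball x s2 \<subseteq> U" using U openE by blast
  define s0 where "s0 = min s1 s2 / 2"
  have s0: "0 < s0" "s0 < s1" "s0 < s2" using s1 s2 by (auto simp: s0_def)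
  have "norm \<eta> = 1" using U(4) by (simp add: \<eta> norm_sgn)
  have ray: "(\<lambda>s. x + s *\<^sub>R (- \<eta>)) ` {0..s0} \<subseteq> closure \<Omega>"
  proof clarsimp
    fix s assume s: "0 \<le> s" "s \<le> s0"
    show "x - s *\<^sub>R \<eta> \<in> closure \<Omega>"
    proof (cases "s = 0")
      case True then show ?thesis using xc by simp
    next
      case False
      then have "x - s *\<^sub>R \<eta> \<in> ball x s2" using s s0 \<open>norm \<eta> = 1\<close> by (simp add: dist_norm)
      moreover have "\<rho> (x - s *\<^sub>R \<eta>) < 0" using s1(2)[of s] s s0 False by simp
      ultimately have "x - s *\<^sub>R \<eta> \<in> \<Omega>" using s2 U(5) by blast
      then show ?thesis using closure_subset by blast
    qed
  qed
  have along: "((\<lambda>s. w (x + s *\<^sub>R (- \<eta>))) has_real_derivative - E \<eta>) (at 0 within {0..s0})"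
    if E: "(w has_derivative E) (at x within closure \<Omega>)" for E
  proof -
    have "((\<lambda>s. w (x + s *\<^sub>R (- \<eta>))) has_derivative (\<lambda>h. E (h *\<^sub>R (- \<eta>)))) (at 0 within {0..s0})"
    proof (rule has_derivative_in_compose[where f = "\<lambda>s. x + s *\<^sub>R (- \<eta>)"])
      show "((\<lambda>s. x + s *\<^sub>R (- \<eta>)) has_derivative (\<lambda>h. h *\<^sub>R (- \<eta>))) (at 0 within {0..s0})"
        by (auto intro!: derivative_eq_intros)
      show "(w has_derivative E) (at (x + 0 *\<^sub>R (- \<eta>)) within (\<lambda>s. x + s *\<^sub>R (- \<eta>)) ` {0..s0})"
        using has_derivative_subset[OF E ray] by simp
    qed
    then show ?thesis
      by (rule has_derivative_imp_has_field_derivative)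
        (simp add: linear_cmul[OF has_derivative_linear[OF E]] linear_neg[OF has_derivative_linear[OF E]])
  qed
  have "- d = - (\<Gamma> \<bullet> \<eta>)"
    using has_field_derivative_unique[OF along[OF D(1)] along[OF w]] s0 D(2)
    by (simp add: trivial_limit_within islimpt_Icc)
  then show ?thesis by simp
qed


section \<open>Cutoff functions near the boundary\<close>

text \<open>Integrating by parts against \<open>\<kappa>\<close> costs \<open>\<Gamma> \<bullet> F\<close>, and replacing 1 by \<open>\<kappa>\<close> costs \<open>1 - \<kappa>\<close>. Both costs are measured by a
single integrable bound, \<open>B\<close>, independent of time, which makes the property stable under products of cutoffs.\<close>

definition boundary_cutoff ::
  "'a::euclidean_space set \<Rightarrow> real set \<Rightarrow> (real \<Rightarrow> 'a \<Rightarrow> 'a) \<Rightarrow> real \<Rightarrow> 'a set \<Rightarrow>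
   ('a \<Rightarrow> real) \<Rightarrow> ('a \<Rightarrow> 'a) \<Rightarrow> ('a \<Rightarrow> real) \<Rightarrow> bool" where
  "boundary_cutoff \<Omega> I F \<delta> V \<kappa> \<Gamma> B \<longleftrightarrow>
     (\<forall>x\<in>\<Omega>. (\<kappa> has_derivative (\<lambda>h. \<Gamma> x \<bullet> h)) (at x) \<and> 0 \<le> \<kappa> x \<and> \<kappa> x \<le> 1) \<and>
     continuous_on \<Omega> \<Gamma> \<and>
     (\<forall>x\<in>\<Omega> \<inter> V. \<kappa> x = 0 \<and> \<Gamma> x = 0) \<and>
     (\<forall>x\<in>\<Omega>. 1 - \<kappa> x \<le> B x \<and> (\<forall>t\<in>I. \<bar>\<Gamma> x \<bullet> F t x\<bar> \<le> B x)) \<and>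
     (\<forall>x. 0 \<le> B x) \<and> integrable lborel B \<and> (\<integral>x. B x \<partial>lborel) \<le> \<delta>"

text \<open>Products replace a partition of unity: they vanish on the union of the two sets, and the errors add up since
both factors lie between 0 and 1.\<close>

lemma boundary_cutoff_mult:
  assumes "boundary_cutoff \<Omega> I F \<delta>1 V1 \<kappa>1 \<Gamma>1 B1" "boundary_cutoff \<Omega> I F \<delta>2 V2 \<kappa>2 \<Gamma>2 B2"
  shows "boundary_cutoff \<Omega> I F (\<delta>1 + \<delta>2) (V1 \<union> V2) (\<lambda>x. \<kappa>1 x * \<kappa>2 x)
           (\<lambda>x. \<kappa>2 x *\<^sub>R \<Gamma>1 x + \<kappa>1 x *\<^sub>R \<Gamma>2 x) (\<lambda>x. B1 x + B2 x)"
proof -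
  note * = assms[unfolded boundary_cutoff_def]
  have cont: "continuous_on \<Omega> \<kappa>1" "continuous_on \<Omega> \<kappa>2"
    using * by (meson continuous_at_imp_continuous_on has_derivative_continuous)+
  have der: "((\<lambda>x. \<kappa>1 x * \<kappa>2 x) has_derivative (\<lambda>h. (\<kappa>2 x *\<^sub>R \<Gamma>1 x + \<kappa>1 x *\<^sub>R \<Gamma>2 x) \<bullet> h)) (at x)"
    if "x \<in> \<Omega>" for x
    by (rule has_derivative_eq_rhs[OF has_derivative_mult]) (use * that in \<open>auto simp: algebra_simps\<close>)
  have le1: "\<kappa>1 x * \<kappa>2 x \<le> 1" if "x \<in> \<Omega>" for x using * that by (intro mult_le_one) auto
  have le2: "1 - \<kappa>1 x * \<kappa>2 x \<le> B1 x + B2 x" if "x \<in> \<Omega>" for x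
  proof -
    have "0 \<le> (1 - \<kappa>1 x) * (1 - \<kappa>2 x)" using * that by (intro mult_nonneg_nonneg) auto
    moreover have "1 - \<kappa>1 x \<le> B1 x" "1 - \<kappa>2 x \<le> B2 x" using * that by auto
    ultimately show ?thesis by (simp add: algebra_simps)
  qed
  have le3: "\<bar>(\<kappa>2 x *\<^sub>R \<Gamma>1 x + \<kappa>1 x *\<^sub>R \<Gamma>2 x) \<bullet> F t x\<bar> \<le> B1 x + B2 x" if "x \<in> \<Omega>" "t \<in> I" for x t
  proof -
    have "\<bar>(\<kappa>2 x *\<^sub>R \<Gamma>1 x + \<kappa>1 x *\<^sub>R \<Gamma>2 x) \<bullet> F t x\<bar>
        \<le> \<bar>\<kappa>2 x\<bar> * \<bar>\<Gamma>1 x \<bullet> F t x\<bar> + \<bar>\<kappa>1 x\<bar> * \<bar>\<Gamma>2 x \<bullet> F t x\<bar>"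
      unfolding abs_mult[symmetric] by (simp add: inner_add_left)
    also have "\<dots> \<le> 1 * B1 x + 1 * B2 x"
      using * that by (intro add_mono mult_mono) auto
    finally show ?thesis by simp
  qed
  show ?thesis
    unfolding boundary_cutoff_def
    using * der le1 le2 le3 cont by (auto intro!: continuous_intros)
qed

text \<open>Near \<open>x0\<close> let \<open>\<rho>\<close> be a defining function and \<open>\<psi>\<close> a bump that equals 1 on the ball of radius \<open>r\<close>. The cutoff is
\<open>\<kappa> = 1 - \<psi> * step_down (- 2 * \<rho> / \<epsilon> - 1)\<close>. It is 0 where \<open>\<psi> = 1\<close> and \<open>\<rho> \<ge> - \<epsilon> / 2\<close>, and it differs from 1
only in the strip \<open>- \<epsilon> < \<rho> < 0\<close>, whose measure is at most a constant times \<open>\<epsilon>\<close>.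
On the strip its gradient is a bounded field plus a bounded multiple
of \<open>\<nabla>\<rho> / \<epsilon>\<close>. By compactness \<open>\<bar>\<nabla>\<rho> \<bullet> F\<bar> \<le> \<gamma>\<close> there once \<open>\<epsilon>\<close> is small, because this product vanishes on
the boundary. Hence the integral of \<open>\<bar>\<nabla>\<kappa> \<bullet> F\<bar>\<close> is at most a constant times \<open>\<epsilon> + \<gamma>\<close>.\<close>

lemma local_boundary_cutoff:
  fixes F :: "real \<Rightarrow> 'a::euclidean_space \<Rightarrow> 'a"
  assumes dom: "bounded_C1_domain \<Omega>" and x0: "x0 \<in> frontier \<Omega>" and I: "compact I"
    and F: "continuous_on (I \<times> closure \<Omega>) (\<lambda>(t, x). F t x)"
    and flux: "\<And>t x \<eta>. t \<in> I \<Longrightarrow> outward_unit_normal \<Omega> x \<eta> \<Longrightarrow> F t x \<bullet> \<eta> = 0"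
  shows "\<exists>r>0. \<forall>\<delta>>0. \<exists>V \<kappa> \<Gamma> B. open V \<and> ball x0 r \<inter> frontier \<Omega> \<subseteq> V \<and>
            boundary_cutoff \<Omega> I F \<delta> V \<kappa> \<Gamma> B"
proof -
  have op: "open \<Omega>" and bd: "bounded \<Omega>" using dom by (auto simp: bounded_C1_domain_def)
  obtain U \<rho> G where loc: "local_defining_function \<Omega> x0 U \<rho> G"
    using dom x0 unfolding bounded_C1_domain_def by blast
  have U: "open U" "x0 \<in> U" "continuous_on U G" "G x0 \<noteq> 0" "\<Omega> \<inter> U = {y \<in> U. \<rho> y < 0}"
    and \<rho>: "\<And>y. y \<in> U \<Longrightarrow> (\<rho> has_derivative (\<lambda>h. G y \<bullet> h)) (at y)"
    and Gnz: "\<And>y. y \<in> U \<Longrightarrow> G y \<noteq> 0"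
    using loc by (auto simp: local_defining_function_def)
  have loc': "local_defining_function \<Omega> y U \<rho> G" if "y \<in> U" for y
    using loc that by (auto simp: local_defining_function_def)
  have cont\<rho>: "continuous_on U \<rho>"
    using \<rho> by (meson continuous_at_imp_continuous_on has_derivative_continuous)
  define e where "e = sgn (G x0)"
  define m where "m = norm (G x0) / 2"
  have m: "0 < m" and e: "norm e \<le> 1" using U by (auto simp: m_def e_def norm_sgn)
  have "G x0 \<bullet> e = norm (G x0)"
    using U(4) by (simp add: e_def sgn_div_norm power2_norm_eq_inner[symmetric] power2_eq_square)
  then have "m < G x0 \<bullet> e" using m by (simp add: m_def)
  moreover have "open (U \<inter> (\<lambda>y. G y \<bullet> e) -` {m<..})"
    by (intro continuous_open_preimage continuous_intros U)
  ultimately obtain R where R: "0 < R" "ball x0 R \<subseteq> U \<inter> (\<lambda>y. G y \<bullet> e) -` {m<..}"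
    using U(2) openE by (metis (no_types, lifting) IntI greaterThan_iff vimageI)
  have RU: "y \<in> U" and Gm: "m \<le> G y \<bullet> e" if "y \<in> ball x0 R" for y using R(2) that by auto
  define r where "r = R / 2"
  have r: "0 < r" using R by (simp add: r_def)
  define \<tau> where "\<tau> x = (x - x0) \<bullet> (x - x0) / r\<^sup>2 - 1" for x
  define \<psi> where "\<psi> x = step_down (\<tau> x)" for x
  define D where "D = {x. \<tau> x \<le> 1}"
  have \<tau>_iff: "\<tau> x \<le> 1 \<longleftrightarrow> (dist x0 x)\<^sup>2 \<le> 2 * r\<^sup>2" for x
    using r by (simp add: \<tau>_def dist_norm norm_minus_commute power2_norm_eq_inner[symmetric] field_simps)
  have DR: "D \<subseteq> ball x0 R"
  proof
    fix x assume "x \<in> D"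
    then have "(dist x0 x)\<^sup>2 \<le> 2 * r\<^sup>2" by (simp add: D_def \<tau>_iff)
    also have "\<dots> < R\<^sup>2" using R(1) by (simp add: r_def power2_eq_square)
    finally show "x \<in> ball x0 R" using R(1) by (simp add: power_less_imp_less_base)
  qed
  have cont\<tau>: "continuous_on S \<tau>" for S unfolding \<tau>_def by (intro continuous_intros) (use r in auto)
  have "closed D" unfolding D_def by (intro closed_Collect_le cont\<tau> continuous_on_const)
  define Z where "Z = closure \<Omega> \<inter> D"
  have compZ: "compact Z"
    unfolding Z_def using bd \<open>closed D\<close> by (metis compact_Int_closed compact_closure)
  have ZU: "x \<in> U" if "x \<in> Z" for x using that DR RU unfolding Z_def by blast
  have "compact (I \<times> closure \<Omega>)" using I bd by (simp add: compact_Times)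
  then have "bounded ((\<lambda>(t, x). F t x) ` (I \<times> closure \<Omega>))"
    by (intro compact_imp_bounded compact_continuous_image F)
  then obtain MF where "\<forall>z\<in>(\<lambda>(t, x). F t x) ` (I \<times> closure \<Omega>). norm z \<le> MF"
    unfolding bounded_iff by blast
  then have MF': "norm (F t x) \<le> MF" if "t \<in> I" "x \<in> closure \<Omega>" for t x using that by force
  define M where "M = max MF 0"
  have M: "0 \<le> M" "\<And>t x. t \<in> I \<Longrightarrow> x \<in> closure \<Omega> \<Longrightarrow> norm (F t x) \<le> M"
    using MF' by (fastforce simp: M_def)+
  define A where "A = 8 * R * M / r\<^sup>2"
  have A: "0 \<le> A" using R M by (simp add: A_def)
  define k where "k = 2 * measure lebesgue (ball x0 (R + 1)) / m + 1"
  have k: "0 < k" using m by (simp add: k_def add_nonneg_pos)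
  have cutoff: "\<exists>V \<kappa> \<Gamma> B. open V \<and> ball x0 r \<inter> frontier \<Omega> \<subseteq> V \<and> boundary_cutoff \<Omega> I F \<delta> V \<kappa> \<Gamma> B"
    if \<delta>: "0 < \<delta>" for \<delta>
  proof -
    define \<gamma> where "\<gamma> = \<delta> / (16 * k)"
    have \<gamma>: "0 < \<gamma>" using \<delta> k by (simp add: \<gamma>_def)
    \<comment> \<open>On the compact set \<open>P\<close> where the normal flux is at least \<open>\<gamma>\<close> the continuous function \<open>\<rho>\<close> is negative,
      since \<open>P\<close> does not meet the frontier; its maximum over \<open>P\<close> gives the threshold.\<close>
    obtain \<epsilon>0 where \<epsilon>0: "0 < \<epsilon>0"
      "\<And>t x. t \<in> I \<Longrightarrow> x \<in> Z \<Longrightarrow> - \<epsilon>0 < \<rho> x \<Longrightarrow> \<bar>G x \<bullet> F t x\<bar> \<le> \<gamma>"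
    proof -
      let ?f = "\<lambda>z. \<bar>G (snd z) \<bullet> F (fst z) (snd z)\<bar>"
      define P where "P = (I \<times> Z) \<inter> ?f -` {\<gamma>..}"
      have contG: "continuous_on (I \<times> Z) (\<lambda>z. G (snd z))"
        by (rule continuous_on_compose2[OF U(3)]) (use ZU in \<open>auto intro!: continuous_intros\<close>)
      have contF: "continuous_on (I \<times> Z) (\<lambda>z. F (fst z) (snd z))"
        using continuous_on_subset[OF F, of "I \<times> Z"] by (auto simp: Z_def case_prod_unfold)
      have "closed P"
        unfolding P_def
        by (intro continuous_closed_preimage continuous_intros contG contF closed_Times
            compact_imp_closed I compZ closed_atLeast)
      moreover have "P \<subseteq> I \<times> Z" by (auto simp: P_def)
      ultimately have compP: "compact P" using I compZ
        by (metis compact_Int_closed compact_Times inf.absorb_iff2)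
      have neg: "\<rho> (snd z) < 0" if "z \<in> P" for z
      proof (rule ccontr)
        let ?x = "snd z"
        assume "\<not> \<rho> ?x < 0"
        have z: "fst z \<in> I" "?x \<in> Z" "?x \<in> closure \<Omega>" "?x \<in> U" "\<gamma> \<le> ?f z"
          using that ZU by (auto simp: P_def Z_def)
        have "?x \<in> frontier \<Omega>"
          using local_defining_function_closure[OF op loc z(3,4)] \<open>\<not> \<rho> ?x < 0\<close> by auto
        then have "outward_unit_normal \<Omega> ?x (sgn (G ?x))"
          using loc'[OF z(4)] by (auto simp: outward_unit_normal_def)
        from flux[OF z(1) this] have "F (fst z) ?x \<bullet> G ?x = 0"
          using Gnz[OF z(4)] by (simp add: sgn_div_norm)
        with z(5) \<gamma> show False by (simp add: inner_commute)
      qed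
      have contP: "continuous_on P (\<lambda>z. \<rho> (snd z))"
        by (rule continuous_on_compose2[OF cont\<rho>]) (use ZU in \<open>auto simp: P_def intro!: continuous_intros\<close>)
      show ?thesis
      proof (cases "P = {}")
        case True
        show ?thesis
        proof (rule that[of 1])
          fix t x assume "t \<in> I" "x \<in> Z"
          then have "(t, x) \<notin> P" using True by simp
          with \<open>t \<in> I\<close> \<open>x \<in> Z\<close> show "\<bar>G x \<bullet> F t x\<bar> \<le> \<gamma>" by (simp add: P_def)
        qed simp
      next
        case False
        obtain z0 where z0: "z0 \<in> P" "\<And>z. z \<in> P \<Longrightarrow> \<rho> (snd z) \<le> \<rho> (snd z0)"
          using continuous_attains_sup[OF compP False contP] by blast
        show ?thesis
        proof (rule that[of "- \<rho> (snd z0)"])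
          fix t x assume *: "t \<in> I" "x \<in> Z" "- (- \<rho> (snd z0)) < \<rho> x"
          have "(t, x) \<notin> P" using z0(2)[of "(t, x)"] * by auto
          with * show "\<bar>G x \<bullet> F t x\<bar> \<le> \<gamma>" by (simp add: P_def)
        qed (use neg[OF z0(1)] in simp)
      qed
    qed
    define \<epsilon> where "\<epsilon> = Min {\<epsilon>0, m, \<delta> / (2 * (1 + A) * k)}"
    have \<epsilon>: "0 < \<epsilon>" "\<epsilon> \<le> \<epsilon>0" "\<epsilon> \<le> m" "\<epsilon> \<le> \<delta> / (2 * (1 + A) * k)"
      using \<epsilon>0 m \<delta> A k by (auto simp: \<epsilon>_def)
    define S where "S = {y \<in> ball x0 R. - \<epsilon> < \<rho> y \<and> \<rho> y < 0}"
    have S: "open S" "measure lebesgue S \<le> 2 * measure lebesgue (ball x0 (R + 1)) / m * \<epsilon>"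
      using measure_strip_le[of x0 R \<rho> G m e \<epsilon>] \<rho> RU Gm m e \<epsilon> unfolding S_def by blast+
    have "2 * measure lebesgue (ball x0 (R + 1)) / m * \<epsilon> \<le> k * \<epsilon>"
      using \<epsilon> by (intro mult_right_mono) (auto simp: k_def)
    with S(2) have S2: "measure lborel S \<le> k * \<epsilon>"
      using S(1) by (simp add: measure_completion)
    define \<sigma> where "\<sigma> x = 2 * (- \<rho> x) / \<epsilon> - 1" for x
    define \<kappa> where "\<kappa> x = 1 - \<psi> x * step_down (\<sigma> x)" for x
    define \<Gamma> where "\<Gamma> x = (if x \<in> ball x0 R then
        - ((step_down (\<sigma> x) * step_down' (\<tau> x) * 2 / r\<^sup>2) *\<^sub>R (x - x0))
        + (\<psi> x * step_down' (\<sigma> x) * 2 / \<epsilon>) *\<^sub>R G x else 0)" for x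
    define V where "V = ball x0 r \<inter> \<rho> -` {- \<epsilon> / 2<..}"
    define b where "b = 1 + A + 8 * \<gamma> / \<epsilon>"
    define B where "B x = b * indicator S x" for x
    have off_D: "\<psi> x = 0" "step_down' (\<tau> x) = 0" if "x \<notin> D" for x
      using that by (auto simp: \<psi>_def D_def)
    have rR: "ball x0 r \<subseteq> ball x0 R" using r by (simp add: r_def subset_ball)
    have openV: "open V"
      unfolding V_def
      by (intro continuous_open_preimage continuous_on_subset[OF cont\<rho>]) (use rR RU in auto)
    have frV: "ball x0 r \<inter> frontier \<Omega> \<subseteq> V"
    proof
      fix x assume x: "x \<in> ball x0 r \<inter> frontier \<Omega>"
      then have "x \<in> U" "x \<in> closure \<Omega>" using rR RU by (auto simp: frontier_def)
      then have "\<rho> x = 0" using local_defining_function_closure[OF op loc] x by auto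
      then show "x \<in> V" using x \<epsilon> by (simp add: V_def)
    qed
    have zero: "\<kappa> x = 0 \<and> \<Gamma> x = 0" if "x \<in> V" for x
    proof -
      have "dist x0 x < r" using that by (simp add: V_def)
      then have "(dist x0 x)\<^sup>2 \<le> r\<^sup>2" using power_mono[of "dist x0 x" r 2] by simp
      then have "\<tau> x \<le> 0"
        using r by (simp add: \<tau>_def dist_norm norm_minus_commute power2_norm_eq_inner[symmetric])
      moreover have "\<sigma> x \<le> 0" using that \<epsilon> by (simp add: V_def \<sigma>_def field_simps)
      ultimately show ?thesis by (simp add: \<kappa>_def \<Gamma>_def \<psi>_def)
    qed
    have deriv: "(\<kappa> has_derivative (\<lambda>h. \<Gamma> x \<bullet> h)) (at x)" for x
    proof (cases "x \<in> ball x0 R")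
      case True
      have 1: "(\<psi> has_derivative (\<lambda>h. (2 / r\<^sup>2 * ((x - x0) \<bullet> h)) * step_down' (\<tau> x))) (at x)"
        unfolding \<psi>_def
        by (rule has_derivative_compose[where f = \<tau>,
              OF _ step_down_has_real_derivative[unfolded has_field_derivative_def, THEN has_derivative_eq_rhs]])
          (use r in \<open>auto simp: \<tau>_def[abs_def] fun_eq_iff inner_commute power2_eq_square field_simps
             intro!: derivative_eq_intros\<close>)
      have 2: "((\<lambda>x. step_down (\<sigma> x)) has_derivative (\<lambda>h. (- 2 / \<epsilon> * (G x \<bullet> h)) * step_down' (\<sigma> x))) (at x)"
        by (rule has_derivative_compose[where f = \<sigma>,
              OF _ step_down_has_real_derivative[unfolded has_field_derivative_def, THEN has_derivative_eq_rhs]])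
          (use \<epsilon> \<rho>[OF RU[OF True]] in \<open>auto simp: \<sigma>_def[abs_def] fun_eq_iff field_simps
             intro!: derivative_eq_intros\<close>)
      show ?thesis
        unfolding \<kappa>_def[abs_def]
        by (rule has_derivative_eq_rhs[OF has_derivative_diff[OF has_derivative_const has_derivative_mult[OF 1 2]]])
          (use True in \<open>simp add: \<Gamma>_def fun_eq_iff inner_add_left inner_diff_left algebra_simps diff_divide_distrib\<close>)
    next
      case False
      then have "x \<in> - D" using DR by auto
      have "((\<lambda>x. 1) has_derivative (\<lambda>h. \<Gamma> x \<bullet> h)) (at x)" using False by (simp add: \<Gamma>_def)
      then show ?thesis
        by (rule has_derivative_transform_within_open[where s = "- D"])
          (use \<open>x \<in> - D\<close> \<open>closed D\<close> off_D in \<open>auto simp: \<kappa>_def\<close>)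
    qed
    have cont\<Gamma>: "continuous_on UNIV \<Gamma>"
    proof -
      have "continuous_on (ball x0 R) \<Gamma>"
      proof -
        have c\<sigma>: "continuous_on (ball x0 R) \<sigma>"
          unfolding \<sigma>_def
          by (intro continuous_intros continuous_on_subset[OF cont\<rho>]) (use RU \<epsilon> in auto)
        have cG: "continuous_on (ball x0 R) G" by (rule continuous_on_subset[OF U(3)]) (use RU in auto)
        have "continuous_on (ball x0 R) (\<lambda>x. - ((step_down (\<sigma> x) * step_down' (\<tau> x) * 2 / r\<^sup>2) *\<^sub>R (x - x0))
            + (\<psi> x * step_down' (\<sigma> x) * 2 / \<epsilon>) *\<^sub>R G x)"
          unfolding \<psi>_def by (intro continuous_intros c\<sigma> cG cont\<tau>) (use r \<epsilon> in auto)
        then show ?thesis by (rule continuous_on_eq) (simp add: \<Gamma>_def)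
      qed
      moreover have "continuous_on (- D) \<Gamma>"
        by (rule continuous_on_eq[OF continuous_on_const[of _ 0]]) (auto simp: \<Gamma>_def off_D)
      ultimately have "continuous_on (ball x0 R \<union> - D) \<Gamma>"
        using \<open>closed D\<close> by (intro continuous_on_open_Un) auto
      moreover have "ball x0 R \<union> - D = UNIV" using DR by auto
      ultimately show ?thesis by simp
    qed
    have b: "1 \<le> b" using A \<gamma> \<epsilon> by (simp add: b_def)
    have prod: "0 \<le> \<psi> x * step_down (\<sigma> x) \<and> \<psi> x * step_down (\<sigma> x) \<le> 1" for x
      using step_down_bounds by (auto simp: \<psi>_def intro!: mult_le_one)
    have off_S: "\<kappa> x = 1 \<and> \<Gamma> x = 0" if "x \<in> \<Omega>" "x \<notin> S" for x
    proof (cases "x \<in> D")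
      case False
      then show ?thesis by (simp add: \<kappa>_def \<Gamma>_def off_D)
    next
      case True
      then have "x \<in> ball x0 R" using DR by auto
      moreover have "x \<in> U" using RU[OF \<open>x \<in> ball x0 R\<close>] .
      ultimately have "\<rho> x \<le> - \<epsilon>" using that U(5) by (auto simp: S_def)
      then have "1 \<le> \<sigma> x" using \<epsilon> by (simp add: \<sigma>_def field_simps)
      then show ?thesis by (simp add: \<kappa>_def \<Gamma>_def)
    qed
    have flux_le: "\<bar>\<Gamma> x \<bullet> F t x\<bar> \<le> b" if x: "x \<in> \<Omega>" "x \<in> S" and t: "t \<in> I" for x t
    proof (cases "x \<in> D")
      case False
      then show ?thesis using b by (simp add: \<Gamma>_def off_D)
    next
      case True
      have xR: "x \<in> ball x0 R" using DR True by auto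
      have xc: "x \<in> closure \<Omega>" using x closure_subset by blast
      then have xZ: "x \<in> Z" using True by (simp add: Z_def)
      have i1: "\<bar>(x - x0) \<bullet> F t x\<bar> \<le> R * M"
      proof -
        have "\<bar>(x - x0) \<bullet> F t x\<bar> \<le> norm (x - x0) * norm (F t x)" by (rule Cauchy_Schwarz_ineq2)
        also have "\<dots> \<le> R * M" using xR R(1) M(2)[OF t xc]
          by (intro mult_mono) (auto simp: dist_norm norm_minus_commute)
        finally show ?thesis .
      qed
      have i2: "\<bar>G x \<bullet> F t x\<bar> \<le> \<gamma>" using \<epsilon>0(2)[OF t xZ] x(2) \<epsilon>(2) by (simp add: S_def)
      have "\<bar>\<Gamma> x \<bullet> F t x\<bar> \<le> \<bar>step_down (\<sigma> x)\<bar> * \<bar>step_down' (\<tau> x)\<bar> * 2 / r\<^sup>2 * \<bar>(x - x0) \<bullet> F t x\<bar>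
          + \<bar>\<psi> x\<bar> * \<bar>step_down' (\<sigma> x)\<bar> * 2 / \<epsilon> * \<bar>G x \<bullet> F t x\<bar>"
      proof -
        have "\<Gamma> x \<bullet> F t x = - (step_down (\<sigma> x) * step_down' (\<tau> x) * 2 / r\<^sup>2 * ((x - x0) \<bullet> F t x))
          + \<psi> x * step_down' (\<sigma> x) * 2 / \<epsilon> * (G x \<bullet> F t x)"
          using xR unfolding \<Gamma>_def by (simp add: inner_diff_left)
        also have "\<bar>\<dots>\<bar> \<le> \<bar>step_down (\<sigma> x) * step_down' (\<tau> x) * 2 / r\<^sup>2 * ((x - x0) \<bullet> F t x)\<bar>
          + \<bar>\<psi> x * step_down' (\<sigma> x) * 2 / \<epsilon> * (G x \<bullet> F t x)\<bar>"
          by (rule order_trans[OF abs_triangle_ineq]) simp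
        finally show ?thesis using \<epsilon> by (simp add: abs_mult)
      qed
      also have "\<dots> \<le> 1 * 4 * 2 / r\<^sup>2 * (R * M) + 1 * 4 * 2 / \<epsilon> * \<gamma>"
        using i1 i2 \<epsilon> r R M step_down_bounds(1)[of "\<sigma> x"] step_down_bounds(1)[of "\<tau> x"]
        by (intro add_mono mult_mono divide_right_mono)
          (auto simp: \<psi>_def step_down_bounds intro!: mult_nonneg_nonneg divide_nonneg_nonneg)
      also have "\<dots> \<le> b" by (simp add: b_def A_def)
      finally show ?thesis .
    qed
    have fin: "emeasure lborel S < \<infinity>"
    proof (rule emeasure_bounded_finite)
      show "bounded S" by (rule bounded_subset[OF bounded_ball[of x0 R]]) (auto simp: S_def)
    qed
    have intB: "integrable lborel B"
      unfolding B_def using S(1) fin by (intro integrable_mult_right integrable_real_indicator) auto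
    have "(\<integral>x. B x \<partial>lborel) = b * measure lborel S" using S(1) by (simp add: B_def)
    also have "\<dots> \<le> b * (k * \<epsilon>)" using S2 b by (intro mult_left_mono) auto
    also have "\<dots> = (1 + A) * k * \<epsilon> + 8 * \<gamma> * k" using \<epsilon> by (simp add: b_def field_simps)
    also have "8 * \<gamma> * k = \<delta> / 2" using k by (simp add: \<gamma>_def)
    also have "(1 + A) * k * \<epsilon> \<le> \<delta> / 2"
    proof -
      have "0 < 2 * (1 + A) * k" using A k by simp
      from \<epsilon>(4)[unfolded pos_le_divide_eq[OF this]] show ?thesis by (simp add: mult_ac)
    qed
    finally have "(\<integral>x. B x \<partial>lborel) \<le> \<delta>" by simp
    then have "boundary_cutoff \<Omega> I F \<delta> V \<kappa> \<Gamma> B"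
      unfolding boundary_cutoff_def
    proof (intro conjI ballI allI)
      fix x assume x: "x \<in> \<Omega>"
      show "0 \<le> \<kappa> x" "\<kappa> x \<le> 1" using prod[of x] by (auto simp: \<kappa>_def)
      then show "1 - \<kappa> x \<le> B x" using off_S[OF x] b by (cases "x \<in> S") (auto simp: B_def)
      fix t assume t: "t \<in> I"
      show "\<bar>\<Gamma> x \<bullet> F t x\<bar> \<le> B x"
        using off_S[OF x] flux_le[OF x _ t] by (cases "x \<in> S") (auto simp: B_def)
    next
      show "0 \<le> B x" for x using b by (simp add: B_def)
    qed (use deriv zero intB continuous_on_subset[OF cont\<Gamma>] in auto)
    with openV frV show ?thesis by blast
  qed
  show ?thesis using r cutoff by blast
qed

text \<open>Finitely many of the balls from the local construction cover the compact frontier, and the product of the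
corresponding cutoffs vanishes near all of it.\<close>

lemma global_boundary_cutoff:
  fixes F :: "real \<Rightarrow> 'a::euclidean_space \<Rightarrow> 'a"
  assumes dom: "bounded_C1_domain \<Omega>" and I: "compact I"
    and F: "continuous_on (I \<times> closure \<Omega>) (\<lambda>(t, x). F t x)"
    and flux: "\<And>t x \<eta>. t \<in> I \<Longrightarrow> outward_unit_normal \<Omega> x \<eta> \<Longrightarrow> F t x \<bullet> \<eta> = 0"
    and \<delta>: "0 < \<delta>"
  obtains V \<kappa> \<Gamma> B where "open V" "frontier \<Omega> \<subseteq> V" "boundary_cutoff \<Omega> I F \<delta> V \<kappa> \<Gamma> B"
proof -
  have "compact (frontier \<Omega>)"
    using dom by (auto simp: bounded_C1_domain_def intro: compact_frontier_bounded)
  obtain r where r: "\<And>x. x \<in> frontier \<Omega> \<Longrightarrow> 0 < r x"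
    "\<And>x \<delta>. x \<in> frontier \<Omega> \<Longrightarrow> 0 < \<delta> \<Longrightarrow> \<exists>V \<kappa> \<Gamma> B. open V \<and> ball x (r x) \<inter> frontier \<Omega> \<subseteq> V \<and>
        boundary_cutoff \<Omega> I F \<delta> V \<kappa> \<Gamma> B"
    using local_boundary_cutoff[OF dom _ I F flux] by metis
  obtain X where X: "X \<subseteq> frontier \<Omega>" "finite X" "frontier \<Omega> \<subseteq> (\<Union>x\<in>X. ball x (r x))"
    using compactE_image[OF \<open>compact (frontier \<Omega>)\<close>, of "frontier \<Omega>" "\<lambda>x. ball x (r x)"] r(1)
    by (metis (no_types, lifting) UN_I centre_in_ball open_ball subsetI)
  have "\<exists>V \<kappa> \<Gamma> B. open V \<and> (\<Union>x\<in>Y. ball x (r x)) \<inter> frontier \<Omega> \<subseteq> V \<and>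
        boundary_cutoff \<Omega> I F \<delta> V \<kappa> \<Gamma> B" if "finite Y" "Y \<subseteq> frontier \<Omega>" "0 < \<delta>" for Y \<delta>
    using that
  proof (induction Y arbitrary: \<delta> rule: finite_induct)
    case empty
    have "boundary_cutoff \<Omega> I F \<delta> {} (\<lambda>_. 1) (\<lambda>_. 0) (\<lambda>_. 0)"
      using empty by (simp add: boundary_cutoff_def)
    then show ?case by (intro exI[of _ "{}"]) auto
  next
    case (insert y Y)
    obtain V1 \<kappa>1 \<Gamma>1 B1 where 1: "open V1" "(\<Union>x\<in>Y. ball x (r x)) \<inter> frontier \<Omega> \<subseteq> V1"
      "boundary_cutoff \<Omega> I F (\<delta> / 2) V1 \<kappa>1 \<Gamma>1 B1"
      using insert.IH[of "\<delta> / 2"] insert.prems by auto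
    obtain V2 \<kappa>2 \<Gamma>2 B2 where 2: "open V2" "ball y (r y) \<inter> frontier \<Omega> \<subseteq> V2"
      "boundary_cutoff \<Omega> I F (\<delta> / 2) V2 \<kappa>2 \<Gamma>2 B2"
      using r(2)[of y "\<delta> / 2"] insert.prems by auto
    have "open (V1 \<union> V2)" "(\<Union>x\<in>insert y Y. ball x (r x)) \<inter> frontier \<Omega> \<subseteq> V1 \<union> V2"
      using 1 2 by auto
    moreover have "\<delta> / 2 + \<delta> / 2 = \<delta>" by simp
    ultimately show ?case using boundary_cutoff_mult[OF 1(3) 2(3)] by metis
  qed
  from this[OF X(2,1) \<delta>] X(3) show ?thesis using that by (metis inf.absorb2)
qed


section \<open>A comparison principle for integrals\<close>

lemma integrable_indicator_times:
  fixes f :: "'a::euclidean_space \<Rightarrow> real"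
  assumes "open \<Omega>" "bounded \<Omega>" "continuous_on \<Omega> f" "\<And>x. x \<in> \<Omega> \<Longrightarrow> \<bar>f x\<bar> \<le> C"
  shows "integrable lborel (\<lambda>x. indicator \<Omega> x * f x)"
proof (rule Bochner_Integration.integrable_bound)
  show "integrable lborel (\<lambda>x. C * indicator \<Omega> x)"
    using assms emeasure_bounded_finite[of \<Omega>]
    by (intro integrable_mult_right integrable_real_indicator) auto
  show "(\<lambda>x. indicator \<Omega> x * f x) \<in> borel_measurable lborel"
    using borel_measurable_continuous_on_indicator[of \<Omega> f] assms by simp
  show "AE x in lborel. norm (indicator \<Omega> x * f x) \<le> norm (C * indicator \<Omega> x)"
    using assms(4) by (intro AE_I2) (force simp: indicator_def)
qed

lemma compactly_supported_bounded_integrable: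
  fixes f :: "'a::euclidean_space \<Rightarrow> real"
  assumes "open \<Omega>" "bounded \<Omega>" "continuous_on \<Omega> f" "compact (\<Omega> - V)"
    and zero: "\<And>x. x \<in> \<Omega> \<Longrightarrow> x \<in> V \<Longrightarrow> f x = 0"
  shows "\<exists>C. \<forall>x. \<bar>indicator \<Omega> x * f x\<bar> \<le> C" "integrable lborel (\<lambda>x. indicator \<Omega> x * f x)"
proof -
  have "bounded (f ` (\<Omega> - V))"
    using assms by (intro compact_imp_bounded compact_continuous_image) (auto intro: continuous_on_subset)
  then obtain C where C: "\<And>x. x \<in> \<Omega> - V \<Longrightarrow> \<bar>f x\<bar> \<le> C"
    unfolding bounded_iff real_norm_def by blast
  have le: "\<bar>f x\<bar> \<le> max C 0" if "x \<in> \<Omega>" for x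
    using C[of x] zero[of x] that by (cases "x \<in> V") auto
  then show "\<exists>C. \<forall>x. \<bar>indicator \<Omega> x * f x\<bar> \<le> C"
    by (intro exI[of _ "max C 0"]) (auto simp: indicator_def)
  show "integrable lborel (\<lambda>x. indicator \<Omega> x * f x)"
    using assms le by (intro integrable_indicator_times) auto
qed

text \<open>Apply the divergence theorem to the compactly supported field \<open>\<kappa> f\<close>: the integral of
\<open>\<kappa> * div f + \<Gamma> \<bullet> f\<close> vanishes, and the second summand is dominated by \<open>B\<close>. The
divergence is built from one-dimensional derivatives along the basis vectors because a classical solution
provides its second derivatives in that form.\<close>

lemma integral_divergence_le_cutoff:
  fixes f :: "'a::euclidean_space \<Rightarrow> 'a" and df :: "'a \<Rightarrow> 'a \<Rightarrow> real"
  assumes dom: "open \<Omega>" "bounded \<Omega>" and V: "open V" "frontier \<Omega> \<subseteq> V"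
    and cut: "boundary_cutoff \<Omega> I F \<delta> V \<kappa> \<Gamma> B" and t: "t \<in> I" "F t = f"
    and contf: "continuous_on \<Omega> f"
    and df: "\<And>x e. x \<in> \<Omega> \<Longrightarrow> e \<in> Basis \<Longrightarrow> ((\<lambda>h. f (x + h *\<^sub>R e) \<bullet> e) has_real_derivative df e x) (at 0)"
    and contdf: "\<And>e. e \<in> Basis \<Longrightarrow> continuous_on \<Omega> (df e)"
    and le: "\<And>x. x \<in> \<Omega> \<Longrightarrow> g x \<le> (\<Sum>e\<in>Basis. df e x)"
    and int: "integrable lborel (\<lambda>x. indicator \<Omega> x * (\<kappa> x * g x))"
  shows "(\<integral>x. indicator \<Omega> x * (\<kappa> x * g x) \<partial>lborel) \<le> \<delta>"
proof -
  note c = cut[unfolded boundary_cutoff_def]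
  have der\<kappa>: "(\<kappa> has_derivative (\<lambda>h. \<Gamma> x \<bullet> h)) (at x)" if "x \<in> \<Omega>" for x using c that by auto
  have zero: "\<kappa> x = 0" "\<Gamma> x = 0" if "x \<in> \<Omega>" "x \<in> V" for x using c that by auto
  have cont\<kappa>: "continuous_on \<Omega> \<kappa>"
    using der\<kappa> by (meson continuous_at_imp_continuous_on has_derivative_continuous)
  have cont\<Gamma>: "continuous_on \<Omega> \<Gamma>" using c by auto
  have "\<Omega> - V = closure \<Omega> - V" using V(2) dom(1) by (auto simp: closure_Un_frontier)
  then have compact: "compact (\<Omega> - V)" using dom V by (simp add: compact_diff)
  define w where "w e x = indicator \<Omega> x * (\<kappa> x * (f x \<bullet> e))" for e x
  define w' where "w' e x = indicator \<Omega> x * ((\<Gamma> x \<bullet> e) * (f x \<bullet> e) + \<kappa> x * df e x)" for e x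
  have w: "integrable lborel (w e)" if "e \<in> Basis" for e
    unfolding w_def
    by (rule compactly_supported_bounded_integrable[where V = V])
      (use dom compact zero in \<open>auto intro!: continuous_intros cont\<kappa> contf\<close>)
  have contw': "continuous_on \<Omega> (\<lambda>x. (\<Gamma> x \<bullet> e) * (f x \<bullet> e) + \<kappa> x * df e x)" if "e \<in> Basis" for e
    by (intro continuous_intros cont\<kappa> cont\<Gamma> contf contdf that)
  have w': "integrable lborel (w' e)" "\<exists>C. \<forall>x. \<bar>w' e x\<bar> \<le> C" if "e \<in> Basis" for e
    unfolding w'_def
    by (rule compactly_supported_bounded_integrable[where V = V]; use dom compact zero contw'[OF that] in auto)+
  have w'0: "(\<integral>x. w' e x \<partial>lborel) = 0" if e: "e \<in> Basis" for e
  proof -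
    obtain C where C: "\<And>x. \<bar>w' e x\<bar> \<le> C" using w'(2)[OF e] by blast
    show ?thesis
    proof (rule integral_directional_derivative_eq_0[where w = "w e" and e = e and V = \<Omega>])
      fix x
      show "((\<lambda>h. w e (x + h *\<^sub>R e)) has_real_derivative w' e x) (at 0)"
      proof (cases "x \<in> \<Omega>")
        case True
        have "((\<lambda>h. \<kappa> (x + h *\<^sub>R e)) has_derivative (\<lambda>h. \<Gamma> x \<bullet> (h *\<^sub>R e))) (at 0)"
        proof (rule has_derivative_compose[where f = "\<lambda>h. x + h *\<^sub>R e"])
          show "((\<lambda>h. x + h *\<^sub>R e) has_derivative (\<lambda>h. h *\<^sub>R e)) (at 0)"
            by (auto intro!: derivative_eq_intros)
          show "(\<kappa> has_derivative (\<bullet>) (\<Gamma> x)) (at (x + 0 *\<^sub>R e))" using der\<kappa>[OF True] by simp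
        qed
        then have "((\<lambda>h. \<kappa> (x + h *\<^sub>R e)) has_real_derivative (\<Gamma> x \<bullet> e)) (at 0)"
          by (rule has_derivative_imp_has_field_derivative) simp
        from DERIV_mult[OF this df[OF True e]]
        have "((\<lambda>h. \<kappa> (x + h *\<^sub>R e) * (f (x + h *\<^sub>R e) \<bullet> e)) has_real_derivative w' e x) (at 0)"
          using True by (simp add: w'_def algebra_simps)
        moreover have "open ((\<lambda>h. x + h *\<^sub>R e) -` \<Omega>)"
          using dom(1) by (intro open_vimage continuous_intros)
        ultimately show ?thesis
          by (rule has_field_derivative_transform_within_open) (use True in \<open>auto simp: w_def\<close>)
      next
        case False
        have "((\<lambda>h. 0) has_real_derivative w' e x) (at 0)" using False by (simp add: w'_def)
        moreover have "open ((\<lambda>h. x + h *\<^sub>R e) -` (- (\<Omega> - V)))"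
          using compact by (intro open_vimage continuous_intros open_Compl compact_imp_closed)
        ultimately show ?thesis
          by (rule has_field_derivative_transform_within_open)
            (use False zero in \<open>auto simp: w_def indicator_def\<close>)
      qed
    next
      show "w' e \<in> borel_measurable lborel" using w'(1)[OF e] by simp
    qed (use C w[OF e] dom in \<open>auto simp: w_def w'_def\<close>)
  qed
  have "indicator \<Omega> x * (\<kappa> x * g x) \<le> (\<Sum>e\<in>Basis. w' e x) + B x" for x
  proof (cases "x \<in> \<Omega>")
    case True
    have "\<kappa> x * g x \<le> \<kappa> x * (\<Sum>e\<in>Basis. df e x)" using le True c by (intro mult_left_mono) auto
    also have "\<dots> = (\<Sum>e\<in>Basis. w' e x) - \<Gamma> x \<bullet> f x"
      using True by (simp add: w'_def sum.distrib sum_distrib_left euclidean_inner[of "\<Gamma> x" "f x"])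
    also have "\<dots> \<le> (\<Sum>e\<in>Basis. w' e x) + B x"
    proof -
      have "\<bar>\<Gamma> x \<bullet> f x\<bar> \<le> B x" using c True t by auto
      then show ?thesis by linarith
    qed
    finally show ?thesis using True by simp
  next
    case False
    then show ?thesis using c by (simp add: w'_def)
  qed
  then have "(\<integral>x. indicator \<Omega> x * (\<kappa> x * g x) \<partial>lborel) \<le> (\<integral>x. (\<Sum>e\<in>Basis. w' e x) + B x \<partial>lborel)"
    using int w'(1) c by (intro integral_mono) auto
  also have "\<dots> = (\<integral>x. B x \<partial>lborel)"
    using w'(1) c w'0 by (simp add: Bochner_Integration.integral_sum)
  also have "\<dots> \<le> \<delta>" using c by auto
  finally show ?thesis .
qed

text \<open>A replacement for the divergence theorem when neither \<open>H'\<close> nor the divergence of \<open>F\<close> is known to be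
integrable over \<open>\<Omega>\<close>: the divergence is only ever integrated against a cutoff. With a cutoff of
error \<open>\<delta>\<close> the integral of \<open>\<kappa> * H\<close> grows at rate at most \<open>\<delta>\<close> by the preceding lemma, and it differs from the
integral of \<open>H\<close> by at most \<open>\<delta>\<close> times the maximum of \<open>H\<close>; then \<open>\<delta>\<close> tends to 0.\<close>

lemma integral_antimono_of_divergence_bound:
  fixes H H' :: "real \<Rightarrow> 'a::euclidean_space \<Rightarrow> real" and F :: "real \<Rightarrow> 'a \<Rightarrow> 'a"
    and dF :: "'a \<Rightarrow> real \<Rightarrow> 'a \<Rightarrow> real"
  assumes dom: "bounded_C1_domain \<Omega>" and t12: "t1 \<le> t2"
  defines "I \<equiv> {t1..t2}"
  assumes contF: "continuous_on (I \<times> closure \<Omega>) (\<lambda>(t, x). F t x)"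
    and flux: "\<And>t x \<eta>. t \<in> I \<Longrightarrow> outward_unit_normal \<Omega> x \<eta> \<Longrightarrow> F t x \<bullet> \<eta> = 0"
    and contH: "continuous_on (I \<times> closure \<Omega>) (\<lambda>(t, x). H t x)"
    and H_nonneg: "\<And>t x. t \<in> I \<Longrightarrow> x \<in> \<Omega> \<Longrightarrow> 0 \<le> H t x"
    and derH: "\<And>t x. t \<in> I \<Longrightarrow> x \<in> \<Omega> \<Longrightarrow> ((\<lambda>s. H s x) has_real_derivative H' t x) (at t)"
    and contH': "continuous_on (I \<times> \<Omega>) (\<lambda>(t, x). H' t x)"
    and derF: "\<And>t x e. t \<in> I \<Longrightarrow> x \<in> \<Omega> \<Longrightarrow> e \<in> Basis \<Longrightarrow>
          ((\<lambda>h. F t (x + h *\<^sub>R e) \<bullet> e) has_real_derivative dF e t x) (at 0)"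
    and contdF: "\<And>t e. t \<in> I \<Longrightarrow> e \<in> Basis \<Longrightarrow> continuous_on \<Omega> (dF e t)"
    and le: "\<And>t x. t \<in> I \<Longrightarrow> x \<in> \<Omega> \<Longrightarrow> H' t x \<le> (\<Sum>e\<in>Basis. dF e t x)"
  shows "(\<integral>x. indicator \<Omega> x * H t2 x \<partial>lborel) \<le> (\<integral>x. indicator \<Omega> x * H t1 x \<partial>lborel)"
proof -
  have op: "open \<Omega>" and bd: "bounded \<Omega>" using dom by (auto simp: bounded_C1_domain_def)
  have I: "compact I" "convex I" "t1 \<in> I" "t2 \<in> I" using t12 by (auto simp: I_def)
  have sub: "\<Omega> \<subseteq> closure \<Omega>" by (rule closure_subset)
  have slice: "continuous_on S (f t)" if "continuous_on (I \<times> S) (\<lambda>(t, x). f t x)" "t \<in> I"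
    for f :: "real \<Rightarrow> 'a \<Rightarrow> 'b::real_normed_vector" and S t
    using continuous_on_compose2[OF that(1) continuous_on_Pair[OF continuous_on_const continuous_on_id], of t S]
      that(2) by auto
  have "compact (I \<times> closure \<Omega>)" using I bd by (simp add: compact_Times)
  then have "bounded ((\<lambda>(t, x). H t x) ` (I \<times> closure \<Omega>))"
    by (intro compact_imp_bounded compact_continuous_image contH)
  then obtain M where M: "\<forall>z\<in>(\<lambda>(t, x). H t x) ` (I \<times> closure \<Omega>). \<bar>z\<bar> \<le> M"
    unfolding bounded_iff real_norm_def by blast
  have HM: "\<bar>H t x\<bar> \<le> max M 0" if "t \<in> I" "x \<in> \<Omega>" for t x using M that sub by force
  have contHt: "continuous_on \<Omega> (H t)" if "t \<in> I" for t
    using slice[OF contH that] sub continuous_on_subset by blast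
  have intH: "integrable lborel (\<lambda>x. indicator \<Omega> x * H t x)" if "t \<in> I" for t
    using contHt HM that by (intro integrable_indicator_times op bd) auto
  have approx: "(\<integral>x. indicator \<Omega> x * H t2 x \<partial>lborel)
      \<le> (\<integral>x. indicator \<Omega> x * H t1 x \<partial>lborel) + \<delta> * (t2 - t1 + max M 0)" if \<delta>: "0 < \<delta>" for \<delta>
  proof -
    obtain V \<kappa> \<Gamma> B where V: "open V" "frontier \<Omega> \<subseteq> V" and cut: "boundary_cutoff \<Omega> I F \<delta> V \<kappa> \<Gamma> B"
      using global_boundary_cutoff[OF dom I(1) contF flux \<delta>] by blast
    note c = cut[unfolded boundary_cutoff_def]
    have cont\<kappa>: "continuous_on \<Omega> \<kappa>"
      using c by (meson continuous_at_imp_continuous_on has_derivative_continuous)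
    have "\<Omega> - V = closure \<Omega> - V" using V(2) op by (auto simp: closure_Un_frontier)
    then have comp: "compact (\<Omega> - V)" using bd V by (simp add: compact_diff)
    have "compact (I \<times> (\<Omega> - V))" using I comp by (simp add: compact_Times)
    then have "bounded ((\<lambda>(t, x). H' t x) ` (I \<times> (\<Omega> - V)))"
      by (intro compact_imp_bounded compact_continuous_image continuous_on_subset[OF contH']) auto
    then obtain N where N: "\<forall>z\<in>(\<lambda>(t, x). H' t x) ` (I \<times> (\<Omega> - V)). \<bar>z\<bar> \<le> N"
      unfolding bounded_iff real_norm_def by blast
    define y where "y t = (\<integral>x. indicator \<Omega> x * (\<kappa> x * H t x) \<partial>lborel)" for t
    define D where "D t = (\<integral>x. indicator \<Omega> x * (\<kappa> x * H' t x) \<partial>lborel)" for t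
    have \<kappa>01: "0 \<le> \<kappa> x" "\<kappa> x \<le> 1" if "x \<in> \<Omega>" for x using c that by auto
    have int\<kappa>H: "integrable lborel (\<lambda>x. indicator \<Omega> x * (\<kappa> x * H t x))" if "t \<in> I" for t
      by (rule compactly_supported_bounded_integrable[where V = V])
        (use op bd comp c in \<open>auto intro!: continuous_intros cont\<kappa> contHt that\<close>)
    have int\<kappa>H': "integrable lborel (\<lambda>x. indicator \<Omega> x * (\<kappa> x * H' t x))" if "t \<in> I" for t
      by (rule compactly_supported_bounded_integrable[where V = V])
        (use op bd comp c in \<open>auto intro!: continuous_intros cont\<kappa> slice[OF contH' that]\<close>)
    have "(y has_real_derivative D t) (at t within I)" if t: "t \<in> I" for t
      unfolding y_def D_def
    proof (rule has_real_derivative_integral[where B = "\<lambda>x. max N 0 * indicator \<Omega> x"])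
      fix s x assume s: "s \<in> I"
      show "((\<lambda>s. indicator \<Omega> x * (\<kappa> x * H s x)) has_real_derivative
          indicator \<Omega> x * (\<kappa> x * H' s x)) (at s within I)"
        using derH[OF s, of x, THEN has_field_derivative_at_within]
        by (cases "x \<in> \<Omega>") (auto intro!: DERIV_cmult)
      show "\<bar>indicator \<Omega> x * (\<kappa> x * H' s x)\<bar> \<le> max N 0 * indicator \<Omega> x"
      proof (cases "x \<in> \<Omega> - V")
        case True
        then have "\<bar>H' s x\<bar> \<le> N" using N s by force
        then have "\<bar>\<kappa> x\<bar> * \<bar>H' s x\<bar> \<le> 1 * max N 0" using True \<kappa>01[of x] by (intro mult_mono) auto
        then show ?thesis using True by (simp add: abs_mult)
      next
        case False
        then show ?thesis using c by (cases "x \<in> \<Omega>") auto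
      qed
    next
      show "integrable lborel (\<lambda>x. max N 0 * indicator \<Omega> x)"
        using op emeasure_bounded_finite[OF bd] by (intro integrable_mult_right integrable_real_indicator) auto
    qed (use I t int\<kappa>H int\<kappa>H' in \<open>auto dest: borel_measurable_integrable\<close>)
    then have "\<exists>t\<in>{t1..t2}. y t2 - y t1 = D t * (t2 - t1)"
      using t12 by (intro mvt_very_simple) (auto simp: I_def has_field_derivative_def)
    then obtain t where t: "t \<in> I" "y t2 - y t1 = D t * (t2 - t1)" by (auto simp: I_def)
    have "D t \<le> \<delta>"
      unfolding D_def
      by (rule integral_divergence_le_cutoff[OF op bd V cut t(1) refl])
        (use t(1) slice[OF contF t(1)] sub derF contdF le int\<kappa>H' in \<open>auto intro: continuous_on_subset\<close>)
    then have "y t2 \<le> y t1 + \<delta> * (t2 - t1)"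
      using t(2) t12 mult_right_mono[of "D t" \<delta> "t2 - t1"] by linarith
    moreover have "y t1 \<le> (\<integral>x. indicator \<Omega> x * H t1 x \<partial>lborel)"
      unfolding y_def
    proof (intro integral_mono int\<kappa>H intH I)
      show "indicator \<Omega> x * (\<kappa> x * H t1 x) \<le> indicator \<Omega> x * H t1 x" for x
        using \<kappa>01[of x] H_nonneg[OF I(3), of x] by (auto simp: indicator_def mult_left_le_one_le)
    qed
    moreover have "(\<integral>x. indicator \<Omega> x * H t2 x \<partial>lborel) \<le> y t2 + max M 0 * \<delta>"
    proof -
      have "(\<integral>x. indicator \<Omega> x * H t2 x \<partial>lborel)
          \<le> (\<integral>x. indicator \<Omega> x * (\<kappa> x * H t2 x) + max M 0 * B x \<partial>lborel)"
      proof (intro integral_mono Bochner_Integration.integrable_add int\<kappa>H intH I integrable_mult_right)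
        show "integrable lborel B" using c by auto
        show "indicator \<Omega> x * H t2 x \<le> indicator \<Omega> x * (\<kappa> x * H t2 x) + max M 0 * B x" for x
        proof (cases "x \<in> \<Omega>")
          case True
          have "(1 - \<kappa> x) * H t2 x \<le> B x * max M 0"
            using True c \<kappa>01[of x] HM[OF I(4) True] H_nonneg[OF I(4) True] by (intro mult_mono) auto
          then show ?thesis using True by (simp add: algebra_simps)
        next
          case False
          then show ?thesis using c by simp
        qed
      qed
      also have "\<dots> = y t2 + max M 0 * (\<integral>x. B x \<partial>lborel)"
        using c int\<kappa>H[OF I(4)] by (simp add: y_def)
      also have "\<dots> \<le> y t2 + max M 0 * \<delta>"
        using c by (intro add_left_mono mult_left_mono) auto
      finally show ?thesis .
    qed
    ultimately show ?thesis by (simp add: algebra_simps)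
  qed
  show ?thesis
  proof (rule field_le_epsilon)
    fix \<epsilon> :: real assume \<epsilon>: "0 < \<epsilon>"
    let ?k = "t2 - t1 + max M 0"
    have k: "0 \<le> ?k" using t12 by simp
    have "\<epsilon> / (?k + 1) * ?k \<le> \<epsilon>" using \<epsilon> k by (simp add: field_simps)
    moreover have "0 < \<epsilon> / (?k + 1)" using \<epsilon> k by simp
    ultimately show "(\<integral>x. indicator \<Omega> x * H t2 x \<partial>lborel)
        \<le> (\<integral>x. indicator \<Omega> x * H t1 x \<partial>lborel) + \<epsilon>"
      using approx[of "\<epsilon> / (?k + 1)"] by linarith
  qed
qed


section \<open>The functional along a solution\<close>

lemma binomial_form_mono_arguments:
  assumes "\<And>i. i \<le> n \<Longrightarrow> 0 \<le> \<tau> i" "0 \<le> x" "x \<le> x'" "0 \<le> y" "y \<le> y'"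
  shows "binomial_form n \<tau> x y \<le> binomial_form n \<tau> x' y'"
  unfolding binomial_form_eq_sum using assms
  by (intro sum_mono mult_mono power_mono) auto

lemma time_interval_downward:
  assumes "t \<in> time_interval T" "0 < s" "s \<le> t"
  shows "s \<in> time_interval T"
  using assms le_less_trans[of "ereal s" "ereal t" T] by (simp add: time_interval_def)

text \<open>One gradient field describes the solution up to the boundary and, inside \<open>\<Omega>\<close>, agrees with the iterated
partial derivatives from which the Laplacian is formed.\<close>

lemma classical_regularity_gradient:
  assumes reg: "classical_regularity \<Omega> T w" and op: "open \<Omega>"
  obtains G where "continuous_on (time_interval T \<times> closure \<Omega>) (\<lambda>(t, x). G t x)"
    "\<And>t x. t \<in> time_interval T \<Longrightarrow> x \<in> closure \<Omega> \<Longrightarrow>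
       (w t has_derivative (\<lambda>h. G t x \<bullet> h)) (at x within closure \<Omega>)"
    "\<And>t x e. t \<in> time_interval T \<Longrightarrow> x \<in> \<Omega> \<Longrightarrow>
       ((\<lambda>h. w t (x + h *\<^sub>R e)) has_real_derivative G t x \<bullet> e) (at 0)"
    "\<And>t x e. t \<in> time_interval T \<Longrightarrow> x \<in> \<Omega> \<Longrightarrow> e \<in> Basis \<Longrightarrow>
       ((\<lambda>h. G t (x + h *\<^sub>R e) \<bullet> e) has_real_derivative partial_deriv e (partial_deriv e (w t)) x) (at 0)"
proof -
  obtain G where G: "continuous_on (time_interval T \<times> closure \<Omega>) (\<lambda>(t, x). G t x)"
    "\<And>t x. t \<in> time_interval T \<Longrightarrow> x \<in> closure \<Omega> \<Longrightarrow>
       (w t has_derivative (\<lambda>h. G t x \<bullet> h)) (at x within closure \<Omega>)"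
    using reg unfolding classical_regularity_def by blast
  have first: "((\<lambda>h. w t (x + h *\<^sub>R e)) has_real_derivative G t x \<bullet> e) (at 0)"
    if t: "t \<in> time_interval T" and x: "x \<in> \<Omega>" for t x e
  proof -
    have "x \<in> interior (closure \<Omega>)"
      using x interior_maximal[OF closure_subset op] by blast
    then have "at x within closure \<Omega> = at x" by (rule at_within_interior)
    then have "(w t has_derivative (\<lambda>h. G t x \<bullet> h)) (at (x + 0 *\<^sub>R e))"
      using G(2)[OF t subsetD[OF closure_subset x]] by simp
    moreover have "((\<lambda>h. x + h *\<^sub>R e) has_derivative (\<lambda>h. h *\<^sub>R e)) (at 0)"
      by (auto intro!: derivative_eq_intros)
    ultimately have "((\<lambda>h. w t (x + h *\<^sub>R e)) has_derivative (\<lambda>h. G t x \<bullet> (h *\<^sub>R e))) (at 0)"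
      by (rule has_derivative_compose[where f = "\<lambda>h. x + h *\<^sub>R e", rotated])
    then show ?thesis by (rule has_derivative_imp_has_field_derivative) simp
  qed
  have pd: "partial_deriv e (w t) x = G t x \<bullet> e" if "t \<in> time_interval T" "x \<in> \<Omega>" for t x e
    unfolding partial_deriv_def using first[OF that] by (rule DERIV_imp_deriv)
  have second: "((\<lambda>h. G t (x + h *\<^sub>R e) \<bullet> e) has_real_derivative partial_deriv e (partial_deriv e (w t)) x) (at 0)"
    if t: "t \<in> time_interval T" and x: "x \<in> \<Omega>" and e: "e \<in> Basis" for t x e
  proof -
    have "(\<lambda>h. partial_deriv e (w t) (x + h *\<^sub>R e)) differentiable (at 0)"
      using reg t x e unfolding classical_regularity_def by blast
    then have "((\<lambda>h. partial_deriv e (w t) (x + h *\<^sub>R e)) has_real_derivative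
        partial_deriv e (partial_deriv e (w t)) x) (at 0)"
      unfolding partial_deriv_def[of e "partial_deriv e (w t)"]
      by (simp add: DERIV_deriv_iff_real_differentiable)
    moreover have "open ((\<lambda>h. x + h *\<^sub>R e) -` \<Omega>)"
      using op by (intro open_vimage continuous_intros)
    ultimately show ?thesis
      by (rule has_field_derivative_transform_within_open) (use x pd[OF t] in auto)
  qed
  show ?thesis using that[OF G first second] by blast
qed

lemma classical_regularity_time_derivative:
  assumes "classical_regularity \<Omega> T w" "t \<in> time_interval T" "x \<in> \<Omega>"
  shows "((\<lambda>s. w s x) has_real_derivative deriv (\<lambda>s. w s x) t) (at t)"
  using assms by (simp add: classical_regularity_def DERIV_deriv_iff_real_differentiable)

text \<open>The comparison principle applied to the flux \<open>F = a * H\<^sub>u * \<nabla>u + b * H\<^sub>v * \<nabla>v\<close>. By the chain rule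
\<open>div F = a * H\<^sub>u * \<Delta>u + b * H\<^sub>v * \<Delta>v\<close> plus the nonnegative Hessian form. By the equations, the
time derivative of \<open>H\<close> is the same combination of Laplacians plus the reaction term, which is nonpositive by assumption.\<close>

lemma binomial_form_integral_antimono:
  fixes \<Omega> :: "'a::euclidean_space set" and u v :: "real \<Rightarrow> 'a \<Rightarrow> real" and \<tau> :: "nat \<Rightarrow> real"
  defines "\<tau>1 \<equiv> \<lambda>i. \<tau> (Suc i)" and "\<tau>2 \<equiv> \<lambda>i. \<tau> (Suc (Suc i))"
  assumes dom: "bounded_C1_domain \<Omega>" and ab: "0 < a" "0 < b"
    and sol: "classical_solution \<Omega> a b f g u0 v0 T u v"
    and nonneg: "\<And>t x. t \<in> time_interval T \<Longrightarrow> x \<in> \<Omega> \<Longrightarrow> 0 \<le> u t x \<and> 0 \<le> v t x"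
    and t12: "t1 \<le> t2" "t1 \<in> time_interval T" "t2 \<in> time_interval T"
    and \<tau>: "\<And>i. 0 < \<tau> i"
      "\<And>i. ((a + b) * \<tau> (Suc i))\<^sup>2 \<le> 4 * a * b * \<tau> i * \<tau> (Suc (Suc i))"
    and reaction: "\<And>t x. t \<in> {t1..t2} \<Longrightarrow> x \<in> \<Omega> \<Longrightarrow>
        binomial_form (p - 1) \<tau>1 (u t x) (v t x) * f t x (u t x) (v t x)
        + binomial_form (p - 1) \<tau> (u t x) (v t x) * g t x (u t x) (v t x) \<le> 0"
  shows "(\<integral>x. indicator \<Omega> x * binomial_form p \<tau> (u t2 x) (v t2 x) \<partial>lborel)
       \<le> (\<integral>x. indicator \<Omega> x * binomial_form p \<tau> (u t1 x) (v t1 x) \<partial>lborel)"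
proof -
  let ?T = "time_interval T"
  have op: "open \<Omega>" using dom by (simp add: bounded_C1_domain_def)
  have sub: "\<Omega> \<subseteq> closure \<Omega>" by (rule closure_subset)
  have I: "{t1..t2} \<subseteq> ?T"
  proof
    fix t assume "t \<in> {t1..t2}"
    then show "t \<in> ?T" using t12 by (intro time_interval_downward[OF t12(3)]) (auto simp: time_interval_def)
  qed
  have reg: "classical_regularity \<Omega> T u" "classical_regularity \<Omega> T v"
    using sol by (auto simp: classical_solution_def)
  obtain Gu where Gu: "continuous_on (?T \<times> closure \<Omega>) (\<lambda>(t, x). Gu t x)"
    "\<And>t x. t \<in> ?T \<Longrightarrow> x \<in> closure \<Omega> \<Longrightarrow> (u t has_derivative (\<lambda>h. Gu t x \<bullet> h)) (at x within closure \<Omega>)"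
    "\<And>t x e. t \<in> ?T \<Longrightarrow> x \<in> \<Omega> \<Longrightarrow> ((\<lambda>h. u t (x + h *\<^sub>R e)) has_real_derivative Gu t x \<bullet> e) (at 0)"
    "\<And>t x e. t \<in> ?T \<Longrightarrow> x \<in> \<Omega> \<Longrightarrow> e \<in> Basis \<Longrightarrow>
       ((\<lambda>h. Gu t (x + h *\<^sub>R e) \<bullet> e) has_real_derivative partial_deriv e (partial_deriv e (u t)) x) (at 0)"
    using classical_regularity_gradient[OF reg(1) op] by blast
  obtain Gv where Gv: "continuous_on (?T \<times> closure \<Omega>) (\<lambda>(t, x). Gv t x)"
    "\<And>t x. t \<in> ?T \<Longrightarrow> x \<in> closure \<Omega> \<Longrightarrow> (v t has_derivative (\<lambda>h. Gv t x \<bullet> h)) (at x within closure \<Omega>)"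
    "\<And>t x e. t \<in> ?T \<Longrightarrow> x \<in> \<Omega> \<Longrightarrow> ((\<lambda>h. v t (x + h *\<^sub>R e)) has_real_derivative Gv t x \<bullet> e) (at 0)"
    "\<And>t x e. t \<in> ?T \<Longrightarrow> x \<in> \<Omega> \<Longrightarrow> e \<in> Basis \<Longrightarrow>
       ((\<lambda>h. Gv t (x + h *\<^sub>R e) \<bullet> e) has_real_derivative partial_deriv e (partial_deriv e (v t)) x) (at 0)"
    using classical_regularity_gradient[OF reg(2) op] by blast
  have contuv: "continuous_on (?T \<times> closure \<Omega>) (\<lambda>z. u (fst z) (snd z))"
    "continuous_on (?T \<times> closure \<Omega>) (\<lambda>z. v (fst z) (snd z))"
    using reg by (simp_all add: classical_regularity_def case_prod_unfold)
  have contG: "continuous_on (?T \<times> closure \<Omega>) (\<lambda>z. Gu (fst z) (snd z))"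
    "continuous_on (?T \<times> closure \<Omega>) (\<lambda>z. Gv (fst z) (snd z))"
    using Gu(1) Gv(1) by (simp_all add: case_prod_unfold)
  have contt: "continuous_on (?T \<times> \<Omega>) (\<lambda>z. deriv (\<lambda>s. u s (snd z)) (fst z))"
    "continuous_on (?T \<times> \<Omega>) (\<lambda>z. deriv (\<lambda>s. v s (snd z)) (fst z))"
    using reg by (simp_all add: classical_regularity_def case_prod_unfold)
  have contd: "continuous_on (?T \<times> \<Omega>) (\<lambda>z. partial_deriv e (partial_deriv e (u (fst z))) (snd z))"
    "continuous_on (?T \<times> \<Omega>) (\<lambda>z. partial_deriv e (partial_deriv e (v (fst z))) (snd z))"
    if "e \<in> Basis" for e
    using reg that by (simp_all add: classical_regularity_def case_prod_unfold)
  have slice: "continuous_on S (\<lambda>x. h (t, x))" if "continuous_on (?T \<times> S') h" "t \<in> ?T" "S \<subseteq> S'"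
    for h :: "real \<times> 'a \<Rightarrow> 'b::real_normed_vector" and S S' t
    by (rule continuous_on_compose2[OF that(1) continuous_on_Pair[OF continuous_on_const continuous_on_id]])
      (use that in auto)
  define F where "F t x = (a * p * binomial_form (p - 1) \<tau>1 (u t x) (v t x)) *\<^sub>R Gu t x
      + (b * p * binomial_form (p - 1) \<tau> (u t x) (v t x)) *\<^sub>R Gv t x" for t x
  define H' where "H' t x = p * (binomial_form (p - 1) \<tau>1 (u t x) (v t x) * deriv (\<lambda>s. u s x) t
      + binomial_form (p - 1) \<tau> (u t x) (v t x) * deriv (\<lambda>s. v s x) t)" for t x
  define Huu where "Huu t x = binomial_form (p - 1 - 1) \<tau>2 (u t x) (v t x)" for t x
  define Huv where "Huv t x = binomial_form (p - 1 - 1) \<tau>1 (u t x) (v t x)" for t x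
  define Hvv where "Hvv t x = binomial_form (p - 1 - 1) \<tau> (u t x) (v t x)" for t x
  define dF where "dF e t x =
      a * p * (real (p - 1) * (Huu t x * (Gu t x \<bullet> e) + Huv t x * (Gv t x \<bullet> e)) * (Gu t x \<bullet> e)
               + binomial_form (p - 1) \<tau>1 (u t x) (v t x) * partial_deriv e (partial_deriv e (u t)) x)
    + b * p * (real (p - 1) * (Huv t x * (Gu t x \<bullet> e) + Hvv t x * (Gv t x \<bullet> e)) * (Gv t x \<bullet> e)
               + binomial_form (p - 1) \<tau> (u t x) (v t x) * partial_deriv e (partial_deriv e (v t)) x)" for e t x
  show ?thesis
  proof (rule integral_antimono_of_divergence_bound[OF dom t12(1), where F = F and H' = H' and dF = dF])
    have "continuous_on (?T \<times> closure \<Omega>) (\<lambda>z. F (fst z) (snd z))"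
      unfolding F_def by (intro continuous_intros contuv contG)
    then show "continuous_on ({t1..t2} \<times> closure \<Omega>) (\<lambda>(t, x). F t x)"
      using I by (auto simp: case_prod_unfold intro: continuous_on_subset)
  next
    have "continuous_on (?T \<times> closure \<Omega>) (\<lambda>z. binomial_form p \<tau> (u (fst z) (snd z)) (v (fst z) (snd z)))"
      by (intro continuous_intros contuv)
    then show "continuous_on ({t1..t2} \<times> closure \<Omega>) (\<lambda>(t, x). binomial_form p \<tau> (u t x) (v t x))"
      using I by (auto simp: case_prod_unfold intro: continuous_on_subset)
  next
    have "?T \<times> \<Omega> \<subseteq> ?T \<times> closure \<Omega>" using sub by auto
    then have "continuous_on (?T \<times> \<Omega>) (\<lambda>z. H' (fst z) (snd z))"
      unfolding H'_def by (intro continuous_intros contt contuv[THEN continuous_on_subset])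
    then show "continuous_on ({t1..t2} \<times> \<Omega>) (\<lambda>(t, x). H' t x)"
      using I by (auto simp: case_prod_unfold intro: continuous_on_subset)
  next
    fix t x \<eta> assume t: "t \<in> {t1..t2}" and \<eta>: "outward_unit_normal \<Omega> x \<eta>"
    have x: "x \<in> frontier \<Omega>" "x \<in> closure \<Omega>" using \<eta> by (auto simp: outward_unit_normal_def frontier_def)
    have tT: "t \<in> ?T" using t I by blast
    have "has_normal_derivative \<Omega> (u t) 0 x" "has_normal_derivative \<Omega> (v t) 0 x"
      using sol tT x(1) by (auto simp: classical_solution_def)
    then have "Gu t x \<bullet> \<eta> = 0" "Gv t x \<bullet> \<eta> = 0"
      using normal_derivative_eq_inner[OF op _ \<eta>] Gu(2)[OF tT x(2)] Gv(2)[OF tT x(2)] by blast+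
    then show "F t x \<bullet> \<eta> = 0" by (simp add: F_def inner_add_left)
  next
    fix t x assume t: "t \<in> {t1..t2}" and x: "x \<in> \<Omega>"
    have tT: "t \<in> ?T" using t I by blast
    note uv = nonneg[OF tT x]
    show "0 \<le> binomial_form p \<tau> (u t x) (v t x)" using uv \<tau>(1) by (intro binomial_form_nonneg) (auto intro: less_imp_le)
    show "((\<lambda>s. binomial_form p \<tau> (u s x) (v s x)) has_real_derivative H' t x) (at t)"
      unfolding H'_def \<tau>1_def
      by (intro binomial_form_has_real_derivative classical_regularity_time_derivative[OF reg(1) tT x]
          classical_regularity_time_derivative[OF reg(2) tT x])
    have ut: "deriv (\<lambda>s. u s x) t = a * laplacian (u t) x + f t x (u t x) (v t x)"
      "deriv (\<lambda>s. v s x) t = b * laplacian (v t) x + g t x (u t x) (v t x)"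
      using sol tT x unfolding classical_solution_def by (metis diff_eq_eq add.commute)+
    define A where "A = binomial_form (p - 1) \<tau>1 (u t x) (v t x)"
    define B where "B = binomial_form (p - 1) \<tau> (u t x) (v t x)"
    have "H' t x = p * (a * A * laplacian (u t) x + b * B * laplacian (v t) x)
        + p * (A * f t x (u t x) (v t x) + B * g t x (u t x) (v t x))"
      unfolding H'_def ut A_def B_def by (simp add: algebra_simps)
    also have "\<dots> \<le> p * (a * A * laplacian (u t) x + b * B * laplacian (v t) x)"
      using reaction[OF t x] by (simp add: A_def B_def mult_nonneg_nonpos)
    also have "\<dots> = (\<Sum>e\<in>Basis. p * (a * A * partial_deriv e (partial_deriv e (u t)) x
        + b * B * partial_deriv e (partial_deriv e (v t)) x))"
      by (simp add: laplacian_def sum.distrib sum_distrib_left distrib_left)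
    also have "\<dots> \<le> (\<Sum>e\<in>Basis. dF e t x)"
    proof (rule sum_mono)
      fix e :: 'a
      let ?X = "Gu t x \<bullet> e" and ?Y = "Gv t x \<bullet> e"
      have "0 \<le> a * Huu t x * ?X\<^sup>2 + (a + b) * Huv t x * ?X * ?Y + b * Hvv t x * ?Y\<^sup>2"
        unfolding Huu_def Huv_def Hvv_def \<tau>1_def \<tau>2_def
        using uv \<tau> ab by (intro binomial_form_hessian_nonneg) auto
      then have "0 \<le> (real p * real (p - 1)) *
          (a * Huu t x * ?X\<^sup>2 + (a + b) * Huv t x * ?X * ?Y + b * Hvv t x * ?Y\<^sup>2)"
        by (intro mult_nonneg_nonneg) auto
      moreover have "dF e t x = p * (a * A * partial_deriv e (partial_deriv e (u t)) x
          + b * B * partial_deriv e (partial_deriv e (v t)) x) + (real p * real (p - 1)) *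
          (a * Huu t x * ?X\<^sup>2 + (a + b) * Huv t x * ?X * ?Y + b * Hvv t x * ?Y\<^sup>2)"
        unfolding dF_def A_def B_def by (simp add: power2_eq_square algebra_simps)
      ultimately show "p * (a * A * partial_deriv e (partial_deriv e (u t)) x
          + b * B * partial_deriv e (partial_deriv e (v t)) x) \<le> dF e t x"
        by linarith
    qed
    finally show "H' t x \<le> (\<Sum>e\<in>Basis. dF e t x)" .
    fix e :: 'a assume e: "e \<in> Basis"
    note du = Gu(3)[OF tT x, of e] and dv = Gv(3)[OF tT x, of e]
    note ddu = Gu(4)[OF tT x e] and ddv = Gv(4)[OF tT x e]
    have "((\<lambda>h. (a * p * binomial_form (p - 1) \<tau>1 (u t (x + h *\<^sub>R e)) (v t (x + h *\<^sub>R e))) * (Gu t (x + h *\<^sub>R e) \<bullet> e)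
         + (b * p * binomial_form (p - 1) \<tau> (u t (x + h *\<^sub>R e)) (v t (x + h *\<^sub>R e))) * (Gv t (x + h *\<^sub>R e) \<bullet> e))
       has_real_derivative dF e t x) (at 0)"
      by (rule DERIV_cong[OF DERIV_add[
            OF DERIV_mult[OF DERIV_cmult[OF binomial_form_has_real_derivative[OF du dv]] ddu]
               DERIV_mult[OF DERIV_cmult[OF binomial_form_has_real_derivative[OF du dv]] ddv]]])
        (simp add: dF_def Huu_def Huv_def Hvv_def \<tau>1_def \<tau>2_def algebra_simps)
    then show "((\<lambda>h. F t (x + h *\<^sub>R e) \<bullet> e) has_real_derivative dF e t x) (at 0)"
      by (simp add: F_def inner_add_left)
  next
    fix t and e :: 'a assume t: "t \<in> {t1..t2}" and e: "e \<in> Basis"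
    have tT: "t \<in> ?T" using t I by blast
    note s = slice[OF contuv(1) tT sub] slice[OF contuv(2) tT sub] slice[OF contG(1) tT sub]
      slice[OF contG(2) tT sub] slice[OF contd(1)[OF e] tT subset_refl] slice[OF contd(2)[OF e] tT subset_refl]
    show "continuous_on \<Omega> (dF e t)"
      unfolding dF_def Huu_def Huv_def Hvv_def
      using s by (intro continuous_intros) simp_all
  qed
qed

text \<open>Continuity up to the boundary gives bounds on compact time intervals only away from \<open>t = 0\<close>; near 0 the bound
is part of attaining the initial datum.\<close>

lemma solution_bounded_up_to:
  fixes \<Omega> :: "'a::euclidean_space set"
  assumes "bounded \<Omega>" and reg: "classical_regularity \<Omega> T w" and init: "attains_initial_datum \<Omega> T w w0"
    and t1: "t1 \<in> time_interval T"
  shows "\<exists>U. \<forall>t\<in>time_interval T. t \<le> t1 \<longrightarrow> (\<forall>x\<in>\<Omega>. \<bar>w t x\<bar> \<le> U)"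
proof -
  obtain \<delta> B where \<delta>: "0 < \<delta>"
    "\<And>t x. t \<in> time_interval T \<Longrightarrow> t \<le> \<delta> \<Longrightarrow> x \<in> \<Omega> \<Longrightarrow> \<bar>w t x\<bar> \<le> B"
    using init unfolding attains_initial_datum_def by blast
  have sub: "{\<delta>..t1} \<subseteq> time_interval T"
  proof
    fix t assume "t \<in> {\<delta>..t1}"
    then show "t \<in> time_interval T" using \<delta>(1) by (intro time_interval_downward[OF t1]) auto
  qed
  have "continuous_on (time_interval T \<times> closure \<Omega>) (\<lambda>(t, x). w t x)"
    using reg by (simp add: classical_regularity_def)
  then have "continuous_on ({\<delta>..t1} \<times> closure \<Omega>) (\<lambda>(t, x). w t x)"
    by (rule continuous_on_subset) (use sub in auto)
  moreover have "compact ({\<delta>..t1} \<times> closure \<Omega>)" using assms(1) by (simp add: compact_Times)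
  ultimately have "bounded ((\<lambda>(t, x). w t x) ` ({\<delta>..t1} \<times> closure \<Omega>))"
    by (intro compact_imp_bounded compact_continuous_image)
  then obtain M where M: "\<forall>z\<in>(\<lambda>(t, x). w t x) ` ({\<delta>..t1} \<times> closure \<Omega>). \<bar>z\<bar> \<le> M"
    unfolding bounded_iff real_norm_def by blast
  have "\<bar>w t x\<bar> \<le> max B M" if t: "t \<in> time_interval T" "t \<le> t1" and x: "x \<in> \<Omega>" for t x
  proof (cases "t \<le> \<delta>")
    case True
    then show ?thesis using \<delta>(2)[OF t(1) True x] by simp
  next
    case False
    then have "(t, x) \<in> {\<delta>..t1} \<times> closure \<Omega>" using t x closure_subset by force
    then have "\<bar>w t x\<bar> \<le> M" using M by force
    then show ?thesis by simp
  qed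
  then show ?thesis by blast
qed

lemma theta_Suc: "theta d K (Suc i) = d * K ^ (2 * i + 1) * theta d K i"
proof -
  have "(Suc i)\<^sup>2 = (2 * i + 1) + i\<^sup>2" by (simp add: power2_eq_square)
  then have "K ^ ((Suc i)\<^sup>2) = K ^ (2 * i + 1) * K ^ (i\<^sup>2)" by (simp only: power_add)
  then show ?thesis unfolding theta_def by (simp only: Suc_eq_plus1 power_add power_one_right mult_ac)
qed

theorem mainTheorem1:
  fixes \<Omega> :: "'a::euclidean_space set"
    and a b r C1 C2 K c C tbar :: real
    and T :: ereal
    and p :: nat
    and \<phi> f g :: "real \<Rightarrow> 'a \<Rightarrow> real \<Rightarrow> real \<Rightarrow> real"
    and u v :: "real \<Rightarrow> 'a \<Rightarrow> real"
    and u0 v0 :: "'a \<Rightarrow> real"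
    and \<theta> :: "nat \<Rightarrow> real"
  assumes domain: "bounded_C1_domain \<Omega>"
    and ab: "a > 0" "b > 0"
    and phi_C1: "C1_on ({0..} \<times> \<Omega> \<times> UNIV \<times> UNIV) (\<lambda>(t, x, s1, s2). \<phi> t x s1 s2)"
    and phi_zero: "\<And>t x s. t > 0 \<Longrightarrow> x \<in> \<Omega> \<Longrightarrow> s \<ge> 0 \<Longrightarrow> \<phi> t x s 0 = 0 \<and> \<phi> t x 0 s = 0"
    and growth_const: "r \<ge> 1" "C1 > 0" "C2 > 0"
    and phi_growth: "\<And>t x s1 s2. t > 0 \<Longrightarrow> x \<in> \<Omega> \<Longrightarrow> s1 \<ge> 0 \<Longrightarrow> s2 \<ge> 0 \<Longrightarrow>
                       \<bar>\<phi> t x s1 s2\<bar> \<le> C1 + C2 * (s1 + s2) powr r"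
    and f: "f = (\<lambda>t x s1 s2. - \<phi> t x s1 s2)"
    and g: "g = (\<lambda>t x s1 s2. \<phi> t x s1 s2)"
    and u0: "set_borel_measurable lebesgue \<Omega> u0" "bounded (u0 ` \<Omega>)" "\<And>x. x \<in> \<Omega> \<Longrightarrow> u0 x \<ge> 0"
    and v0: "set_borel_measurable lebesgue \<Omega> v0" "bounded (v0 ` \<Omega>)" "\<And>x. x \<in> \<Omega> \<Longrightarrow> v0 x \<ge> 0"
    and sol: "maximal_classical_solution \<Omega> a b f g u0 v0 T u v"
    and blow_up: "blow_up_alternative \<Omega> T u v"
    and nonneg: "\<And>t x. t \<in> time_interval T \<Longrightarrow> x \<in> \<Omega> \<Longrightarrow> u t x \<ge> 0 \<and> v t x \<ge> 0"
    and p: "p \<ge> 1"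
    and tbar: "greatest_zero_time \<Omega> T \<phi> tbar"
    and K: "K > 0" "K\<^sup>2 > (a + b)\<^sup>2 / (4 * a * b)"
    and cC: "c > 0" "C > 0" "c * K ^ (2 * p + 1) < 1" "1 < C * K"
    and theta: "(situation_A \<Omega> T f tbar \<and> \<theta> = theta c K) \<or>
                (situation_B \<Omega> T f tbar \<and> \<theta> = theta C K)"
  shows "\<exists>M>0. \<forall>t\<in>time_interval T. lyapunov \<Omega> p \<theta> u v t \<le> M"
proof -
  let ?T = "time_interval T"
  have op: "open \<Omega>" and bd: "bounded \<Omega>" using domain by (auto simp: bounded_C1_domain_def)
  have csol: "classical_solution \<Omega> a b f g u0 v0 T u v"
    using sol by (simp add: maximal_classical_solution_def)
  have "(a + b)\<^sup>2 - 4 * a * b = (a - b)\<^sup>2" by (simp add: power2_eq_square algebra_simps)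
  then have "4 * a * b \<le> (a + b)\<^sup>2" using zero_le_power2[of "a - b"] by linarith
  moreover have "0 < 4 * a * b" using ab by simp
  ultimately have "1 \<le> (a + b)\<^sup>2 / (4 * a * b)" by (simp only: pos_le_divide_eq mult_1)
  then have "1\<^sup>2 \<le> K\<^sup>2" using K(2) unfolding one_power2 by linarith
  then have K1: "1 \<le> K" by (rule power2_le_imp_le) (use K(1) in linarith)
  \<comment> \<open>The base that gives \<open>\<tau>\<close> the monotonicity opposing the sign of the reaction: with \<open>C\<close> the ratio
    \<open>C * K ^ (2 * i + 1)\<close> of consecutive terms is at least 1, with \<open>c\<close> it is at most 1 up to index \<open>p\<close>.\<close>
  define d where "d = (if situation_A \<Omega> T f tbar then C else c)"
  define \<tau> where "\<tau> = theta d K"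
  define \<tau>1 where "\<tau>1 = (\<lambda>i. \<tau> (Suc i))"
  have d: "0 < d" using cC by (simp add: d_def)
  have pos: "0 < theta d' K i" if "0 < d'" for d' i using that K(1) by (simp add: theta_def)
  have \<tau>_pos: "0 < \<tau> i" for i using pos[OF d] by (simp add: \<tau>_def)
  have \<tau>_inc: "\<tau> i \<le> \<tau>1 i" if A: "situation_A \<Omega> T f tbar" for i
  proof -
    have "1 \<le> C * K ^ 1" using cC by simp
    also have "\<dots> \<le> C * K ^ (2 * i + 1)" using cC K1 by (intro mult_left_mono power_increasing) auto
    finally have "1 * \<tau> i \<le> C * K ^ (2 * i + 1) * \<tau> i" using \<tau>_pos[of i] by (intro mult_right_mono) auto
    then show ?thesis using A by (simp add: \<tau>1_def \<tau>_def d_def theta_Suc)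
  qed
  have \<tau>_dec: "\<tau>1 i \<le> \<tau> i" if B: "\<not> situation_A \<Omega> T f tbar" and i: "i \<le> p - 1" for i
  proof -
    have "c * K ^ (2 * i + 1) \<le> c * K ^ (2 * p + 1)"
      using cC K1 i by (intro mult_left_mono power_increasing) auto
    then have "c * K ^ (2 * i + 1) \<le> 1" using cC(3) by linarith
    then have "c * K ^ (2 * i + 1) * \<tau> i \<le> 1 * \<tau> i" using \<tau>_pos[of i] by (intro mult_right_mono) auto
    then show ?thesis using B by (simp add: \<tau>1_def \<tau>_def d_def theta_Suc)
  qed
  have reaction: "binomial_form (p - 1) \<tau>1 (u t x) (v t x) * f t x (u t x) (v t x)
        + binomial_form (p - 1) \<tau> (u t x) (v t x) * g t x (u t x) (v t x) \<le> 0"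
    if t: "t \<in> ?T" "tbar < t" and x: "x \<in> \<Omega>" for t x
  proof -
    let ?\<phi> = "\<phi> t x (u t x) (v t x)"
    let ?d = "binomial_form (p - 1) \<tau> (u t x) (v t x) - binomial_form (p - 1) \<tau>1 (u t x) (v t x)"
    note uv = nonneg[OF t(1) x]
    have "?d * ?\<phi> \<le> 0"
    proof (cases "0 < u t x \<and> 0 < v t x")
      case False
      then have "?\<phi> = 0" using phi_zero[of t x] uv t(1) x by (auto simp: time_interval_def less_le)
      then show ?thesis by simp
    next
      case True
      show ?thesis
      proof (cases "situation_A \<Omega> T f tbar")
        case A: True
        then have "0 < ?\<phi>" using True t x by (auto simp: situation_A_def f)
        moreover have "?d \<le> 0" using binomial_form_mono[of "p - 1" \<tau> \<tau>1] \<tau>_inc[OF A] uv by simp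
        ultimately show ?thesis by (simp add: mult_nonpos_nonneg)
      next
        case B: False
        then have "?\<phi> < 0" using theta True t x by (auto simp: situation_B_def f)
        moreover have "0 \<le> ?d" using binomial_form_mono[of "p - 1" \<tau>1 \<tau>] \<tau>_dec[OF B] uv by simp
        ultimately show ?thesis by (simp add: mult_nonneg_nonpos)
      qed
    qed
    then show ?thesis by (simp add: f g algebra_simps)
  qed
  define J where "J t = (\<integral>x. indicator \<Omega> x * binomial_form p \<tau> (u t x) (v t x) \<partial>lborel)" for t
  have "ereal tbar < T" "0 < tbar"
    using tbar by (auto simp: greatest_zero_time_def zero_times_def time_interval_def)
  then obtain t1 where t1: "tbar < t1" "ereal t1 < T"
    using ereal_dense2[of "ereal tbar" T] by auto
  have t1T: "t1 \<in> ?T" using t1 \<open>0 < tbar\<close> by (simp add: time_interval_def)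
  have late: "J t \<le> J t1" if "t \<in> ?T" "t1 \<le> t" for t
    unfolding J_def
  proof (rule binomial_form_integral_antimono[OF domain ab csol nonneg that(2) t1T that(1)])
    show "0 < \<tau> i" for i by (rule \<tau>_pos)
    show "((a + b) * \<tau> (Suc i))\<^sup>2 \<le> 4 * a * b * \<tau> i * \<tau> (Suc (Suc i))" for i
      unfolding \<tau>_def using ab K d by (intro theta_discriminant) auto
    fix s x assume s: "s \<in> {t1..t}" and x: "x \<in> \<Omega>"
    have "s \<le> t" "0 < s" "tbar < s" using s t1 t1T by (auto simp: time_interval_def)
    then have "s \<in> ?T" by (intro time_interval_downward[OF that(1)])
    then show "binomial_form (p - 1) (\<lambda>i. \<tau> (Suc i)) (u s x) (v s x) * f s x (u s x) (v s x)
        + binomial_form (p - 1) \<tau> (u s x) (v s x) * g s x (u s x) (v s x) \<le> 0"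
      using reaction[OF _ \<open>tbar < s\<close> x] by (simp add: \<tau>1_def)
  qed
  have integrable: "integrable lborel (\<lambda>x. indicator \<Omega> x * binomial_form p \<sigma> (u t x) (v t x))" if "t \<in> ?T" for t \<sigma>
  proof -
    have "continuous_on (closure \<Omega>) (u t)" "continuous_on (closure \<Omega>) (v t)"
      using csol that unfolding classical_solution_def classical_regularity_def
      by (meson has_derivative_continuous_on)+
    then have cont: "continuous_on (closure \<Omega>) (\<lambda>x. binomial_form p \<sigma> (u t x) (v t x))"
      by (rule continuous_on_binomial_form)
    moreover have "compact (closure \<Omega>)" using bd by simp
    ultimately have "bounded ((\<lambda>x. binomial_form p \<sigma> (u t x) (v t x)) ` closure \<Omega>)"
      by (intro compact_imp_bounded compact_continuous_image)
    then obtain B where "\<And>x. x \<in> closure \<Omega> \<Longrightarrow> \<bar>binomial_form p \<sigma> (u t x) (v t x)\<bar> \<le> B"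
      unfolding bounded_iff real_norm_def by blast
    then show ?thesis
      using closure_subset[of \<Omega>]
      by (intro integrable_indicator_times[where C = B] op bd continuous_on_subset[OF cont]) auto
  qed
  obtain U where U: "\<And>t x. t \<in> ?T \<Longrightarrow> t \<le> t1 \<Longrightarrow> x \<in> \<Omega> \<Longrightarrow> \<bar>u t x\<bar> \<le> U"
    using solution_bounded_up_to[OF bd _ _ t1T, of u u0] csol unfolding classical_solution_def by blast
  obtain W where W: "\<And>t x. t \<in> ?T \<Longrightarrow> t \<le> t1 \<Longrightarrow> x \<in> \<Omega> \<Longrightarrow> \<bar>v t x\<bar> \<le> W"
    using solution_bounded_up_to[OF bd _ _ t1T, of v v0] csol unfolding classical_solution_def by blast
  define N where "N = binomial_form p \<tau> U W * measure lborel \<Omega>"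
  have early: "J t \<le> N" if "t \<in> ?T" "t \<le> t1" for t
  proof -
    have le: "binomial_form p \<tau> (u t x) (v t x) \<le> binomial_form p \<tau> U W" if "x \<in> \<Omega>" for x
      using U[OF \<open>t \<in> ?T\<close> \<open>t \<le> t1\<close> that] W[OF \<open>t \<in> ?T\<close> \<open>t \<le> t1\<close> that] nonneg[OF \<open>t \<in> ?T\<close> that] \<tau>_pos
      by (intro binomial_form_mono_arguments) (auto intro: less_imp_le)
    have "J t \<le> (\<integral>x. binomial_form p \<tau> U W * indicator \<Omega> x \<partial>lborel)"
      unfolding J_def using op emeasure_bounded_finite[OF bd] le integrable[OF that(1)]
      by (intro integral_mono integrable_mult_right integrable_real_indicator) (auto simp: indicator_def)
    then show ?thesis using op by (simp add: N_def)
  qed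
  \<comment> \<open>Any number exceeding all ratios \<open>\<theta> i / \<tau> i\<close> with \<open>i \<le> p\<close> transfers the bound from \<open>\<tau>\<close> to \<open>\<theta>\<close>.\<close>
  define R where "R = (\<Sum>i\<le>p. \<theta> i / \<tau> i)"
  have \<theta>_pos: "0 < \<theta> i" for i using theta cC pos by auto
  have R0: "0 \<le> R" unfolding R_def using \<theta>_pos \<tau>_pos by (intro sum_nonneg) (auto intro: less_imp_le)
  have \<theta>_le: "\<theta> i \<le> R * \<tau> i" if "i \<le> p" for i
  proof -
    have "\<theta> i / \<tau> i \<le> R"
      unfolding R_def using that \<theta>_pos \<tau>_pos by (intro member_le_sum) (auto intro: less_imp_le)
    then show ?thesis using \<tau>_pos[of i] by (simp add: pos_divide_le_eq)
  qed
  have compare: "lyapunov \<Omega> p \<theta> u v t \<le> R * J t" if t: "t \<in> ?T" for t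
  proof -
    have "lyapunov \<Omega> p \<theta> u v t = (\<integral>x. indicator \<Omega> x * binomial_form p \<theta> (u t x) (v t x) \<partial>lborel)"
      unfolding lyapunov_def set_lebesgue_integral_def binomial_form_eq_sum[symmetric]
      using borel_measurable_integrable[OF integrable[OF t]] by (simp add: integral_completion)
    also have "\<dots> \<le> (\<integral>x. R * (indicator \<Omega> x * binomial_form p \<tau> (u t x) (v t x)) \<partial>lborel)"
    proof (intro integral_mono integrable_mult_right integrable t)
      fix x
      show "indicator \<Omega> x * binomial_form p \<theta> (u t x) (v t x) \<le> R * (indicator \<Omega> x * binomial_form p \<tau> (u t x) (v t x))"
      proof (cases "x \<in> \<Omega>")
        case True
        then have "binomial_form p \<theta> (u t x) (v t x) \<le> binomial_form p (\<lambda>i. R * \<tau> i) (u t x) (v t x)"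
          using nonneg[OF t True] \<theta>_le by (intro binomial_form_mono) auto
        then show ?thesis using True by (simp add: binomial_form_scale)
      qed simp
    qed
    finally show ?thesis by (simp add: J_def)
  qed
  have "lyapunov \<Omega> p \<theta> u v t \<le> R * \<bar>N\<bar> + 1" if t: "t \<in> ?T" for t
  proof -
    have "J t \<le> N"
      using early[OF t] late[OF t] early[OF t1T] by (cases "t \<le> t1") auto
    then have "R * J t \<le> R * \<bar>N\<bar>" using R0 by (intro mult_left_mono) auto
    then show ?thesis using compare[OF t] by linarith
  qed
  moreover have "0 < R * \<bar>N\<bar> + 1" using R0 by (simp add: add_nonneg_pos)
  ultimately show ?thesis by blast
qed

end
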